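(* Let $A$ be a finite alphabet with at least two elements. Let $X\in(\omega)_A^\omega$ and let $E$ be an analytic equivalence relation on $[X]$ (i.e. an equivalence relation on $[X]$ that is an analytic subset of $[X]^2$). Then there exists $Y\in(\omega)_A^\omega$ with $Y\preceq X$ such that $E\upharpoonright[Y]=[Y]\times[Y]$, or $E\upharpoonright[Y]=\mathrm{id}([Y])$, or there exists a partition $\mathcal{B}$ of $A$ such that $E\upharpoonright[Y]=E_{\mathcal{B}}\upharpoonright[Y]$. In particular, the ideal $I_{C_2}$ has total canonization for analytic equivalence relations: if $|A|=2$, then for every Borel set $B\subseteq A^\omega$ with $B\notin I_{C_2}$ and every analytic equivalence relation $E$ on $B$ there is a Borel set $C\subseteq B$ with $C\notin I_{C_2}$ such that $E\upharpoonright C=C\times C$ or $E\upharpoonright C=\mathrm{id}(C)$.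
   Context: Here $\omega=\{0,1,2,\dots\}$ and $A$ is a finite set, taken disjoint from $\omega$, with $|A|\ge 2$. For $\alpha\in\omega\cup\{\omega\}$, $(\omega)_A^\alpha$ denotes the set of all partitions $X$ of $A\cup\omega$ such that distinct elements of $A$ lie in distinct pieces of $X$ and $X$ has exactly $\alpha$ pieces containing no element of $A$. The piece containing $a\in A$ is called the $a$-block; pieces containing no element of $A$ are called free blocks. Thus members of $(\omega)_A^\omega$ have infinitely many free blocks and members of $(\omega)_A^0$ have none. Coarsening order: $Y\preceq X$ means that every block of $X$ is contained in some block of $Y$. The set $(\omega)_A^0$ is identified with $A^\omega$: a partition $x\in(\omega)^0_A$ corresponds to the function $x:\omega\to A$ with $x(k)=a$ iff $k$ is in the $a$-block. $A^\omega$ carries the product topology with $A$ discrete. For $X\in(\omega)_A^\omega$, $[X]=\{x\in(\omega)_A^0: x\preceq X\}$, a closed subset of $A^\omega$. For a partition $\mathcal{B}$ of $A$, $E_{\mathcal{B}}$ is the equivalence relation on $A^\omega$ defined by: $x\,E_{\mathcal{B}}\,y$ iff for all $k\in\omega$ and all $B\in\mathcal{B}$, $x(k)\in B\Leftrightarrow y(k)\in B$. $\mathrm{id}(C)=\{(x,x):x\in C\}$, and $E\upharpoonright C=E\cap(C\times C)$. With $n=|A|$, $I_{C_n}$ is the collection of all Borel subsets of $A^\omega$ that do not contain $[X]$ as a subset for any $X\in(\omega)_A^\omega$. *)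

theory Defs
  imports "HOL-Analysis.Analysis" "HOL-Library.Disjoint_Sets" "HOL-Library.Extended_Nat"
begin

text \<open>
  The disjoint union \<open>A \<union> \<omega>\<close> is rendered as the disjoint sum
  \<open>A <+> UNIV\<close>: \<open>Inl a\<close> is the letter \<open>a\<close> and
  \<open>Inr k\<close> is the natural number \<open>k\<close>.
\<close>

definition free_blocks :: "'a set \<Rightarrow> ('a + nat) set set \<Rightarrow> ('a + nat) set set" where
  "free_blocks A X = {p \<in> X. p \<inter> Inl ` A = {}}"

text \<open>
  \<open>parts A \<alpha>\<close> is \<open>(\<omega>)\<close> with subscript \<open>A\<close> and superscript
  \<open>\<alpha>\<close>.  A family of disjoint pieces of the countable set \<open>A \<union> \<omega>\<close> is
  countable, so having exactly \<open>\<omega>\<close> free blocks means having infinitely many.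
\<close>

definition parts :: "'a set \<Rightarrow> enat \<Rightarrow> ('a + nat) set set set" where
  "parts A \<alpha> = {X. partition_on (A <+> UNIV) X \<and>
     (\<forall>a\<in>A. \<forall>b\<in>A. a \<noteq> b \<longrightarrow> (\<forall>p\<in>X. \<not> (Inl a \<in> p \<and> Inl b \<in> p))) \<and>
     (case \<alpha> of
        enat n \<Rightarrow> finite (free_blocks A X) \<and> card (free_blocks A X) = n
      | \<infinity> \<Rightarrow> infinite (free_blocks A X))}"

text \<open>
  \<open>coarser A Y X\<close> is the coarsening order \<open>Y \<preceq> X\<close>; mind the argument order
  of the library relation \<open>refines\<close>, whose finer partition comes first.
\<close>

definition coarser :: "'a set \<Rightarrow> ('a + nat) set set \<Rightarrow> ('a + nat) set set \<Rightarrow> bool" where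
  "coarser A Y X \<longleftrightarrow> refines (A <+> UNIV) X Y"

definition words :: "'a set \<Rightarrow> (nat \<Rightarrow> 'a) topology" where
  "words A = product_topology (\<lambda>_. discrete_topology A) UNIV"

text \<open>
  The identification of \<open>parts A 0\<close> with the functions from \<open>\<omega>\<close> to \<open>A\<close>:
  \<open>word_of A x k\<close> is the letter whose block in \<open>x\<close> contains \<open>k\<close>.
\<close>

definition word_of :: "'a set \<Rightarrow> ('a + nat) set set \<Rightarrow> nat \<Rightarrow> 'a" where
  "word_of A x k = (THE a. a \<in> A \<and> (\<exists>p\<in>x. Inl a \<in> p \<and> Inr k \<in> p))"

definition cube :: "'a set \<Rightarrow> ('a + nat) set set \<Rightarrow> (nat \<Rightarrow> 'a) set" where
  "cube A X = word_of A ` {x \<in> parts A 0. coarser A x X}"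

definition block_rel :: "'a set \<Rightarrow> 'a set set \<Rightarrow> ((nat \<Rightarrow> 'a) \<times> (nat \<Rightarrow> 'a)) set" where
  "block_rel A \<B> = {(x, y). x \<in> topspace (words A) \<and> y \<in> topspace (words A) \<and>
     (\<forall>k. \<forall>B\<in>\<B>. x k \<in> B \<longleftrightarrow> y k \<in> B)}"

definition restrict_rel :: "('b \<times> 'b) set \<Rightarrow> 'b set \<Rightarrow> ('b \<times> 'b) set" where
  "restrict_rel E C = E \<inter> (C \<times> C)"

definition borel_in :: "'b topology \<Rightarrow> 'b set \<Rightarrow> bool" where
  "borel_in T S \<longleftrightarrow> S \<in> sigma_sets (topspace T) {U. openin T U}"

definition baire_space :: "(nat \<Rightarrow> nat) topology" where
  "baire_space = product_topology (\<lambda>_. discrete_topology UNIV) UNIV"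

text \<open>
  Analytic sets as continuous images of the Baire space; the empty set has to be
  added by hand, since the Baire space is nonempty.
\<close>

definition analytic_in :: "'b topology \<Rightarrow> 'b set \<Rightarrow> bool" where
  "analytic_in T S \<longleftrightarrow> S = {} \<or>
     (\<exists>f. continuous_map baire_space T f \<and> f ` topspace baire_space = S)"

text \<open>Equivalence relations on \<open>C\<close> that are analytic subsets of the square of the subspace \<open>C\<close>.\<close>

definition analytic_equiv :: "'b topology \<Rightarrow> 'b set \<Rightarrow> ('b \<times> 'b) set \<Rightarrow> bool" where
  "analytic_equiv T C E \<longleftrightarrow> equiv C E \<and>
     analytic_in (prod_topology (subtopology T C) (subtopology T C)) E"

text \<open>\<open>ideal_C A\<close> is the collection \<open>I\<close> with subscript \<open>C\<^sub>n\<close>, where \<open>n = card A\<close>.\<close>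

definition ideal_C :: "'a set \<Rightarrow> (nat \<Rightarrow> 'a) set set" where
  "ideal_C A = {B. borel_in (words A) B \<and> \<not> (\<exists>X\<in>parts A \<infinity>. cube A X \<subseteq> B)}"

end

theory Submission
  imports Defs "HOL-Library.Omega_Words_Fun"
begin

text \<open>
  A partition in \<open>parts A \<infinity>\<close> is coded by a \<^emph>\<open>pattern\<close>: a sequence \<open>\<theta>\<close> of letters and
  variables \<open>Inr i\<close> in which every variable occurs.  Its cube consists of the words
  \<open>fill z \<circ> \<theta>\<close> with \<open>z\<close> in \<open>A\<^sup>\<omega>\<close>, and coarsening the partition means substituting another
  pattern for the variables.  So an equivalence relation \<open>E\<close> on a cube becomes, via
  \<open>pull\<close>, one on \<open>A\<^sup>\<omega>\<close>, and the theorem asks for a pattern along which \<open>(z, w) \<in> E\<close> only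
  depends on whether all letter pairs \<open>(z k, w k)\<close> lie in a fixed equivalence relation \<open>Q\<close> on
  \<open>A\<close>.

  The relation \<open>Q\<close> is chosen first.  Consider the reflexive relations \<open>R\<close> on \<open>A\<close> such
  that along some pattern all pairs of words that are letterwise \<open>R\<close>-related are
  \<open>E\<close>-related, and let \<open>Q\<close> be a maximal one, with pattern \<open>\<psi>\<close>.  This property is inherited
  by all further substitutions, and for a fixed pattern it passes to converses and
  compositions because \<open>E\<close> is an equivalence.  Hence \<open>Q\<close> is an equivalence relation and it
  absorbs every \<open>R\<close> that has the property along a substitution into \<open>\<psi>\<close>.

  It remains to make all other pairs inequivalent, and this is a matter of category.  For
  reflexive \<open>R\<close>, the pairs of words whose letter pairs lie in \<open>R\<close> form the space \<open>R\<^sup>\<omega>\<close>, in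
  which \<open>E\<close> (pulled back along \<open>\<psi>\<close>) is analytic.  So \<open>E\<close> is meager in \<open>R\<^sup>\<omega>\<close> or comeager
  below some finite word (\<open>projection_meager_or_comeager\<close>).  A comeager \<open>E\<close> yields, by a
  composition argument, a pattern along which all \<open>R\<close>-related words are equivalent, so
  \<open>R \<subseteq> Q\<close> (\<open>comeager_contains_power\<close>).  Thus \<open>E\<close> is meager in \<open>R\<^sup>\<omega>\<close> whenever \<open>R\<close> is not
  contained in \<open>Q\<close>.

  Both uses of category rest on one construction (\<open>fusion\<close>): given countably many dense
  open subsets of each \<open>R\<^sup>\<omega>\<close>, there is a pattern such that any two words of its cube whose
  letter pairs, together with the diagonal, form exactly \<open>R\<close> give a point lying in all the
  dense open sets for \<open>R\<close>.  The pattern is built in finite stages.  To push a pair of values of the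
  first \<open>n\<close> variables into a dense open set one needs a certain finite word over \<open>R\<close>; each
  of its letters is a diagonal pair, produced by a constant, or a pair of values of one of
  the variables, produced by repeating that variable.

  With two letters, the only equivalence relations on \<open>A\<close> are equality and the full one,
  which gives the last part of the theorem; the cubes are closed, hence Borel.
\<close>

section \<open>Baire category through dense sets of finite words\<close>

text \<open>
  A set of finite words over \<open>R\<close> stands for the open set of the sequences that have a prefix
  in it; \<open>dense_words\<close> says that this open set is dense in \<open>R\<^sup>\<omega>\<close>.
\<close>

definition dense_words :: "'b set \<Rightarrow> 'b list set \<Rightarrow> bool" where
  "dense_words R D \<longleftrightarrow> (\<forall>s\<in>lists R. \<exists>t\<in>lists R. s @ t \<in> D)"

definition meets :: "'b word \<Rightarrow> 'b list set \<Rightarrow> bool" where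
  "meets x D \<longleftrightarrow> (\<exists>m. prefix m x \<in> D)"

text \<open>
  Meagerness of \<open>S\<close> in the basic open set of \<open>R\<^sup>\<omega>\<close> given by the prefix \<open>s\<close>.  The dense sets
  are required to be dense everywhere: outside this basic open set they can be enlarged at
  will.
\<close>

definition meager_below :: "'b set \<Rightarrow> 'b list \<Rightarrow> 'b word set \<Rightarrow> bool" where
  "meager_below R s S \<longleftrightarrow> (\<exists>D. (\<forall>k::nat. dense_words R (D k)) \<and>
     (\<forall>x. range x \<subseteq> R \<longrightarrow> prefix (length s) x = s \<longrightarrow> (\<forall>k. meets x (D k)) \<longrightarrow> x \<notin> S))"

lemma meager_below_UN:
  assumes "\<And>j::nat. meager_below R s (S j)"
  shows "meager_below R s (\<Union>j. S j)"
proof -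
  obtain D where D: "\<And>j k::nat. dense_words R (D j k)"
    "\<And>j x. range x \<subseteq> R \<Longrightarrow> prefix (length s) x = s \<Longrightarrow> (\<forall>k. meets x (D j k)) \<Longrightarrow> x \<notin> S j"
    using assms unfolding meager_below_def by metis
  show ?thesis unfolding meager_below_def
  proof (intro exI[of _ "\<lambda>k. case prod_decode k of (j, i) \<Rightarrow> D j i"] conjI allI impI)
    show "dense_words R (case prod_decode k of (j, i) \<Rightarrow> D j i)" for k
      using D(1) by (simp split: prod.split)
    fix x assume x: "range x \<subseteq> R" "prefix (length s) x = s"
      "\<forall>k. meets x (case prod_decode k of (j, i) \<Rightarrow> D j i)"
    have "meets x (D j i)" for j i
      using x(3)[rule_format, of "prod_encode (j, i)"] by simp
    then show "x \<notin> (\<Union>j. S j)" using D(2) x by blast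
  qed
qed

lemma meager_below_mono:
  assumes "meager_below R s S" "\<And>x. range x \<subseteq> R \<Longrightarrow> x \<in> T \<Longrightarrow> x \<in> S"
  shows "meager_below R s T"
  using assms unfolding meager_below_def by metis

lemma prefix_split:
  assumes "m \<le> n" "range x \<subseteq> R"
  obtains r where "r \<in> lists R" "prefix n x = prefix m x @ r"
proof
  show "x [m \<rightarrow> n] \<in> lists R" using assms(2) by (auto simp: subset_iff)
  show "prefix n x = prefix m x @ (x [m \<rightarrow> n])"
    using subsequence_append[of x m "n - m"] assms(1) by simp
qed

text \<open>
  The Banach category theorem for the countable base of finite words.  The words \<open>w\<close> below
  which \<open>S\<close> is meager are dense below \<open>s\<close>, so almost every sequence enters one of them and then
  avoids \<open>S\<close> if it meets the countably many dense sets attached to that \<open>w\<close>.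
\<close>

lemma meager_below_locally:
  assumes R: "finite R" and s: "s \<in> lists R"
    and dense: "\<And>t. t \<in> lists R \<Longrightarrow> \<exists>t'\<in>lists R. meager_below R (s @ t @ t') S"
  shows "meager_below R s S"
proof -
  define W where "W = {w \<in> lists R. meager_below R w S}"
  obtain D where D: "\<And>w k::nat. w \<in> W \<Longrightarrow> dense_words R (D w k)"
    "\<And>w x. w \<in> W \<Longrightarrow> range x \<subseteq> R \<Longrightarrow> prefix (length w) x = w \<Longrightarrow>
      (\<forall>k. meets x (D w k)) \<Longrightarrow> x \<notin> S"
  proof -
    have "\<forall>w\<in>W. \<exists>D. (\<forall>k::nat. dense_words R (D k)) \<and> (\<forall>x. range x \<subseteq> R \<longrightarrow>
      prefix (length w) x = w \<longrightarrow> (\<forall>k. meets x (D k)) \<longrightarrow> x \<notin> S)"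
      unfolding W_def meager_below_def by blast
    from bchoice[OF this] show ?thesis using that by blast
  qed
  have cW: "countable W" unfolding W_def
    by (rule countable_subset[of _ "lists R"]) (auto simp: R countable_finite)
  \<comment> \<open>Words incompatible with \<open>s\<close> are thrown in to make the set dense everywhere.\<close>
  have WD: "dense_words R {r. r \<in> W \<or> (\<forall>u. r \<noteq> s @ u \<and> s \<noteq> r @ u)}"
    (is "dense_words R ?D0")
    unfolding dense_words_def
  proof
    fix r assume r: "r \<in> lists R"
    consider u where "r = s @ u" "u \<in> lists R" | v where "s = r @ v" "v \<in> lists R" | "r \<in> ?D0"
      using s r by fastforce
    then show "\<exists>t\<in>lists R. r @ t \<in> ?D0"
    proof cases
      case 1
      then show ?thesis using dense[of u] s unfolding W_def by auto
    next
      case 2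
      then obtain t where "t \<in> lists R" "meager_below R (s @ [] @ t) S"
        using dense[of "[]"] by auto
      then show ?thesis using 2 s by (intro bexI[of _ "v @ t"]) (auto simp: W_def)
    next
      case 3
      then show ?thesis by (intro bexI[of _ "[]"]) auto
    qed
  qed
  define D' where "D' w k = (if w \<in> W then D w k else UNIV)" for w k
  have D': "dense_words R (D' w k)" for w k
    using D(1) by (auto simp: D'_def dense_words_def)
  define F where "F k = (case prod_decode k of (i, j) \<Rightarrow>
     if i = 0 then ?D0 else D' (from_nat_into W (i - 1)) j)" for k
  show ?thesis unfolding meager_below_def
  proof (intro exI[of _ F] conjI allI impI)
    show "dense_words R (F k)" for k
      using WD D' by (auto simp: F_def split: prod.split)
    fix x assume x: "range x \<subseteq> R" "prefix (length s) x = s" "\<forall>k. meets x (F k)"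
    have "meets x ?D0" using x(3)[rule_format, of "prod_encode (0, 0)"] by (simp add: F_def)
    then obtain m where m: "prefix m x \<in> ?D0" by (auto simp: meets_def)
    have "prefix m x \<in> W"
    proof (cases "m \<le> length s")
      case True
      then obtain r where "s = prefix m x @ r"
        using prefix_split[OF True x(1)] x(2) by metis
      then show ?thesis using m by auto
    next
      case False
      then obtain r where "r \<in> lists R" "prefix m x = s @ r"
        using prefix_split[of "length s" m x R] x(1,2) by auto
      then show ?thesis using m by auto
    qed
    moreover have "meets x (D (prefix m x) k)" for k
    proof -
      obtain i where "from_nat_into W i = prefix m x"
        using \<open>prefix m x \<in> W\<close> cW by (metis from_nat_into_surj)
      then show ?thesis
        using x(3)[rule_format, of "prod_encode (Suc i, k)"] \<open>prefix m x \<in> W\<close>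
        by (simp add: F_def D'_def)
    qed
    ultimately show "x \<notin> S" using D(2)[of "prefix m x" x] x(1) by simp
  qed
qed

text \<open>
  Closedness in \<open>R\<^sup>\<omega> \<times> \<omega>\<^sup>\<omega>\<close>.  Projections of such sets to the first factor are the analytic
  subsets of \<open>R\<^sup>\<omega>\<close>.
\<close>

definition closed_rel :: "'b set \<Rightarrow> ('b word \<Rightarrow> nat word \<Rightarrow> bool) \<Rightarrow> bool" where
  "closed_rel R P \<longleftrightarrow> (\<forall>x b. range x \<subseteq> R \<longrightarrow>
     (\<forall>n. \<exists>x' b'. range x' \<subseteq> R \<and> prefix n x' = prefix n x \<and> prefix n b' = prefix n b \<and> P x' b')
     \<longrightarrow> P x b)"

text \<open>
  Analytic sets have the Baire property, in the form needed here.  Let \<open>S t\<close> be the set of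
  the points that have a witness \<open>b\<close> extending the finite sequence \<open>t\<close>, and \<open>F t\<close> the set of the
  words below which \<open>S t\<close> is nowhere meager.  As \<open>S t\<close> is the countable union of the sets
  \<open>S (t @ [j])\<close>, every word in \<open>F t\<close> can be extended into some \<open>F (t @ [j])\<close>.  So along a generic
  \<open>x\<close> starting in \<open>F []\<close> one can choose the entries of a sequence \<open>b\<close> one by one, staying in
  \<open>F (prefix n b)\<close>.  Then \<open>(x, b)\<close> is a limit of points of \<open>P\<close> and belongs to \<open>P\<close>.
\<close>

lemma projection_meager_or_comeager:
  fixes P :: "'b word \<Rightarrow> nat word \<Rightarrow> bool"
  assumes R: "finite R" and P: "closed_rel R P"
    and nm: "\<not> meager_below R [] {x. \<exists>b. P x b}"
  shows "\<exists>s\<in>lists R. meager_below R s (- {x. \<exists>b. P x b})"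
proof -
  define S where "S t = {x. \<exists>b. prefix (length t) b = t \<and> P x b}" for t
  define F where "F t = {s \<in> lists R. \<forall>r\<in>lists R. \<not> meager_below R (s @ r) (S t)}" for t
  have S_Nil: "S [] = {x. \<exists>b. P x b}" by (simp add: S_def)
  have S_split: "S t = (\<Union>j. S (t @ [j]))" for t
    by (auto simp: S_def)
  have F_ext: "s @ r \<in> F t" if "s \<in> F t" "r \<in> lists R" for s r t
    using that by (auto simp: F_def)
  have F_pre: "prefix n x \<in> F t" if "prefix m x \<in> F t" "m \<le> n" "range x \<subseteq> R" for m n x t
    using prefix_split[OF that(2,3)] F_ext that(1) by metis
  have F_nonmeager: "\<exists>r\<in>lists R. s @ r \<in> F t"
    if s: "s \<in> lists R" and nm: "\<not> meager_below R s (S t)" for s t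
  proof -
    obtain r where r: "r \<in> lists R" "\<forall>r'\<in>lists R. \<not> meager_below R (s @ r @ r') (S t)"
      using meager_below_locally[OF R s, of "S t"] nm by blast
    then show ?thesis using s by (intro bexI[of _ r]) (auto simp: F_def)
  qed
  obtain s where s: "s \<in> F []"
    using F_nonmeager[of "[]" "[]"] nm by (auto simp: S_Nil)
  \<comment> \<open>The second alternative makes \<open>D t\<close> dense; it cannot occur along a sequence with a prefix in
    \<open>F t\<close>, because \<open>F t\<close> is closed under extension.\<close>
  define D where "D t = {s. (\<exists>j. s \<in> F (t @ [j])) \<or> (\<forall>r\<in>lists R. s @ r \<notin> F t)}" for t
  have D_dense: "dense_words R (D t)" for t
    unfolding dense_words_def
  proof
    fix s assume s: "s \<in> lists R"
    show "\<exists>r\<in>lists R. s @ r \<in> D t"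
    proof (cases "\<forall>r\<in>lists R. s @ r \<notin> F t")
      case True
      then show ?thesis by (intro bexI[of _ "[]"]) (auto simp: D_def)
    next
      case False
      then obtain r where r: "r \<in> lists R" "s @ r \<in> F t" by blast
      then have "\<not> meager_below R (s @ r) (S t)"
        unfolding F_def by (metis (no_types, lifting) append_Nil2 lists.Nil mem_Collect_eq)
      then obtain j where "\<not> meager_below R (s @ r) (S (t @ [j]))"
        using meager_below_UN[of R "s @ r" "\<lambda>j. S (t @ [j])"] S_split[of t] by metis
      then obtain r' where "r' \<in> lists R" "(s @ r) @ r' \<in> F (t @ [j])"
        using F_nonmeager[of "s @ r" "t @ [j]"] s r(1) by (metis append_in_lists_conv)
      then show ?thesis using r by (intro bexI[of _ "r @ r'"]) (auto simp: D_def)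
    qed
  qed
  have "meager_below R s (- {x. \<exists>b. P x b})"
    unfolding meager_below_def
  proof (intro exI[of _ "\<lambda>k. D (from_nat k)"] conjI allI impI)
    show "dense_words R (D (from_nat k))" for k by (rule D_dense)
    fix x assume x: "range x \<subseteq> R" "prefix (length s) x = s" "\<forall>k. meets x (D (from_nat k))"
    define Q where "Q t \<longleftrightarrow> (\<exists>m. prefix m x \<in> F t)" for t
    have meets: "meets x (D t)" for t using x(3)[rule_format, of "to_nat t"] by simp
    have step: "\<exists>j. Q (t @ [j])" if "Q t" for t
    proof -
      obtain m where m: "prefix m x \<in> F t" using \<open>Q t\<close> by (auto simp: Q_def)
      obtain l where l: "prefix l x \<in> D t" using meets by (auto simp: meets_def)
      obtain r where "r \<in> lists R" "prefix (max l m) x = prefix l x @ r"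
        using prefix_split[of l "max l m" x R] x(1) by auto
      moreover have "prefix (max l m) x \<in> F t" using F_pre m x(1) by simp
      ultimately show ?thesis using l unfolding D_def Q_def by auto
    qed
    define T where "T = rec_nat [] (\<lambda>_ t. t @ [SOME j. Q (t @ [j])])"
    have T_Suc: "T (Suc n) = T n @ [SOME j. Q (T n @ [j])]" for n by (simp add: T_def)
    have QT: "Q (T n)" for n
    proof (induction n)
      case 0
      then show ?case using s x(2) by (auto simp: Q_def T_def intro!: exI[of _ "length s"])
    next
      case (Suc n)
      then show ?case using someI_ex[OF step] by (simp add: T_Suc)
    qed
    have lenT: "length (T n) = n" for n by (induction n) (auto simp: T_Suc T_def)
    define b where "b n = last (T (Suc n))" for n
    have bT: "prefix n b = T n" for n
      by (induction n) (auto simp: T_Suc b_def, simp add: T_def)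
    have "P x b"
    proof (rule P[unfolded closed_rel_def, rule_format, OF x(1)])
      fix n
      obtain m where m: "prefix m x \<in> F (T n)" using QT by (auto simp: Q_def)
      let ?s = "prefix (max m n) x"
      have "?s \<in> F (T n)" using F_pre[OF m] x(1) by simp
      then have "\<not> meager_below R ?s (S (T n))"
        unfolding F_def by (metis (no_types, lifting) append_Nil2 lists.Nil mem_Collect_eq)
      moreover have "dense_words R UNIV" by (auto simp: dense_words_def)
      ultimately obtain x' where x': "range x' \<subseteq> R" "prefix (max m n) x' = ?s" "x' \<in> S (T n)"
        unfolding meager_below_def by (auto dest!: spec[of _ "\<lambda>_. UNIV"])
      have "prefix n y = take n (prefix (max m n) y)" for y :: "'b word" by (simp add: min_def)
      then have "prefix n x' = prefix n x" using x'(2) by metis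
      then show "\<exists>x' b'. range x' \<subseteq> R \<and> prefix n x' = prefix n x \<and> prefix n b' = prefix n b \<and> P x' b'"
        using x' by (auto simp: S_def lenT bT)
    qed
    then show "x \<notin> - {x. \<exists>b. P x b}" by blast
  qed
  then show ?thesis using s by (auto simp: F_def)
qed

section \<open>Patterns and the fusion construction\<close>

definition fill :: "'a word \<Rightarrow> 'a + nat \<Rightarrow> 'a" where
  "fill z = case_sum id z"

text \<open>
  The variable \<open>Inr i\<close> stands for the \<open>i\<close>-th free block of a partition and the letter \<open>Inl a\<close>
  for membership in the \<open>a\<close>-block; requiring every variable to occur makes all these blocks
  nonempty.
\<close>

definition pattern :: "'a set \<Rightarrow> ('a + nat) word \<Rightarrow> bool" where
  "pattern A \<theta> \<longleftrightarrow> range \<theta> \<subseteq> A <+> UNIV \<and> range Inr \<subseteq> range \<theta>"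

definition pairs :: "'a word \<Rightarrow> 'a word \<Rightarrow> ('a \<times> 'a) word" where
  "pairs x y = (\<lambda>k. (x k, y k))"

text \<open>
  The diagonal is included because every pattern may contribute constants, which show up as
  diagonal letter pairs.  With it, the type does not change when both words are plugged
  into a pattern (\<open>pair_type_fill\<close>).
\<close>

definition pair_type :: "'a set \<Rightarrow> 'a word \<Rightarrow> 'a word \<Rightarrow> ('a \<times> 'a) set" where
  "pair_type A z w = Id_on A \<union> range (pairs z w)"

lemma fill_simps [simp]: "fill z (Inl a) = a" "fill z (Inr i) = z i"
  by (simp_all add: fill_def)

lemma fill_comp [simp]: "fill z \<circ> Inl = id" "fill z \<circ> Inr = z"
  by (simp_all add: fun_eq_iff)

lemma pattern_Inr: "pattern A Inr"
  by (auto simp: pattern_def)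

lemma pattern_letter:
  assumes "pattern A \<theta>" "\<theta> k = Inl a"
  shows "a \<in> A"
proof -
  have "\<theta> k \<in> A <+> UNIV" using assms(1) unfolding pattern_def by blast
  then show ?thesis using assms(2) by auto
qed

lemma pattern_variable:
  assumes "pattern A \<theta>"
  obtains k where "\<theta> k = Inr i"
proof -
  have "Inr i \<in> range \<theta>" using assms unfolding pattern_def by (auto simp: subset_eq)
  then show ?thesis using that by (metis rangeE)
qed

lemma patternI:
  assumes "\<And>k a. \<theta> k = Inl a \<Longrightarrow> a \<in> A" "\<And>i. \<exists>k. \<theta> k = Inr i"
  shows "pattern A \<theta>"
proof -
  have "\<theta> k \<in> A <+> UNIV" for k using assms(1)[of k] by (cases "\<theta> k") auto
  moreover have "Inr i \<in> range \<theta>" for i using assms(2)[of i] by (metis rangeI)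
  ultimately show ?thesis by (auto simp: pattern_def)
qed

lemma pattern_positions:
  assumes "pattern A \<theta>"
  obtains \<kappa> where "\<And>i. \<theta> (\<kappa> i) = Inr i"
proof -
  have "\<exists>k. \<theta> k = Inr i" for i using pattern_variable[OF assms] by blast
  then show ?thesis using that by metis
qed

lemma fill_range:
  assumes "pattern A \<theta>" "range z \<subseteq> A"
  shows "range (fill z \<circ> \<theta>) \<subseteq> A"
proof
  fix a assume "a \<in> range (fill z \<circ> \<theta>)"
  then obtain k where k: "a = fill z (\<theta> k)" by auto
  have "\<theta> k \<in> A <+> UNIV" using assms(1) by (auto simp: pattern_def)
  then show "a \<in> A" using k assms(2) by auto
qed

lemma pairs_conc:
  assumes "length u = length v"
  shows "pairs (u \<frown> x) (v \<frown> y) = zip u v \<frown> pairs x y"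
proof
  show "pairs (u \<frown> x) (v \<frown> y) k = (zip u v \<frown> pairs x y) k" for k
    using assms by (cases "k < length u") (auto simp: pairs_def)
qed

lemma range_pairs_subset:
  assumes "range (pairs z w) \<subseteq> Q" "Q \<subseteq> A \<times> A"
  shows "range z \<subseteq> A" "range w \<subseteq> A"
  using assms by (auto simp: pairs_def)

lemma pair_type_fill:
  assumes "pattern A \<theta>" "range z \<subseteq> A"
  shows "pair_type A (fill z \<circ> \<theta>) (fill w \<circ> \<theta>) = pair_type A z w"
proof (intro equalityI subsetI)
  fix p assume "p \<in> pair_type A (fill z \<circ> \<theta>) (fill w \<circ> \<theta>)"
  then consider "p \<in> Id_on A" | k where "p = (fill z (\<theta> k), fill w (\<theta> k))"
    by (auto simp: pair_type_def pairs_def)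
  then show "p \<in> pair_type A z w"
  proof cases
    case 1
    then show ?thesis by (simp add: pair_type_def)
  next
    case 2
    have "\<theta> k \<in> A <+> UNIV" using assms(1) by (auto simp: pattern_def)
    then consider a where "a \<in> A" "\<theta> k = Inl a" | i where "\<theta> k = Inr i" by blast
    then show ?thesis unfolding 2 by cases (auto simp: pair_type_def pairs_def)
  qed
next
  fix p assume "p \<in> pair_type A z w"
  then consider "p \<in> Id_on A" | i where "p = (z i, w i)"
    by (auto simp: pair_type_def pairs_def)
  then show "p \<in> pair_type A (fill z \<circ> \<theta>) (fill w \<circ> \<theta>)"
  proof cases
    case 1
    then show ?thesis by (simp add: pair_type_def)
  next
    case 2
    have "Inr i \<in> range \<theta>"
      using assms(1) unfolding pattern_def by (auto simp: subset_eq)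
    then obtain k where k: "Inr i = \<theta> k" by (rule rangeE)
    have "p = pairs (fill z \<circ> \<theta>) (fill w \<circ> \<theta>) k" by (simp add: 2 pairs_def flip: k)
    then show ?thesis by (auto simp: pair_type_def)
  qed
qed

lemma extend_finitely_many:
  assumes "finite I" "s \<in> lists B"
    and "\<And>i s. i \<in> I \<Longrightarrow> s \<in> lists B \<Longrightarrow> \<exists>t\<in>lists B. Q i (s @ t)"
    and "\<And>i s t. Q i s \<Longrightarrow> Q i (s @ t)"
  shows "\<exists>t\<in>lists B. \<forall>i\<in>I. Q i (s @ t)"
  using assms(1,3)
proof (induction I rule: finite_induct)
  case empty
  then show ?case by (intro bexI[of _ "[]"]) auto
next
  case (insert i I)
  then obtain t where t: "t \<in> lists B" "\<forall>i\<in>I. Q i (s @ t)" by blast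
  obtain t' where t': "t' \<in> lists B" "Q i ((s @ t) @ t')"
    using insert.prems[of i "s @ t"] t assms(2) by auto
  have "\<forall>j\<in>insert i I. Q j (s @ t @ t')"
    using t(2) t'(2) assms(4) by (metis append.assoc insert_iff)
  then show ?case using t t' by (intro bexI[of _ "t @ t'"]) auto
qed

text \<open>
  The point where the type of a pair of words matters: a diagonal pair is produced by a
  constant and any other pair of the type by repeating a variable that takes these two
  values.
\<close>

lemma realise_letters:
  assumes "r \<in> lists (Id_on A \<union> pairs z w ` {..<n})"
  shows "\<exists>t\<in>lists (A <+> {..<n}). map (\<lambda>c. (fill z c, fill w c)) t = r"
  using assms
proof (induction r rule: list.induct)
  case Nil
  then show ?case by (intro bexI[of _ "[]"]) auto
next
  case (Cons p r)
  then obtain t where t: "t \<in> lists (A <+> {..<n})" "map (\<lambda>c. (fill z c, fill w c)) t = r"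
    by auto
  have "p \<in> Id_on A \<or> (\<exists>i<n. p = (z i, w i))"
  proof -
    have "p \<in> Id_on A \<union> pairs z w ` {..<n}" using Cons.prems by simp
    then show ?thesis unfolding pairs_def by blast
  qed
  then have "\<exists>c\<in>A <+> {..<n}. (fill z c, fill w c) = p"
  proof (elim disjE exE Id_onE conjE)
    show ?thesis if "a \<in> A" "p = (a, a)" for a using that by (intro bexI[of _ "Inl a"]) auto
    show ?thesis if "i < n" "p = (z i, w i)" for i using that by (intro bexI[of _ "Inr i"]) auto
  qed
  then obtain c where "c \<in> A <+> {..<n}" "(fill z c, fill w c) = p" by blast
  then show ?case using t by (intro bexI[of _ "c # t"]) auto
qed

text \<open>
  The pattern is the limit of words \<open>W n\<close> in the variables below \<open>n\<close>.  Passing to \<open>W (Suc n)\<close>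
  introduces the variable \<open>Inr n\<close> and then a block of known variables and constants that
  takes care of finitely many tasks: for each pair of assignments of letters to the
  variables below \<open>Suc n\<close>, reach the first \<open>Suc n\<close> dense sets that belong to its type.  A pair of
  infinite words shows its full type on finitely many variables, so every dense set for
  this type is met at some stage.
\<close>

lemma fusion:
  assumes A: "finite A"
    and D: "\<And>R k::nat. Id_on A \<subseteq> R \<Longrightarrow> R \<subseteq> A \<times> A \<Longrightarrow> dense_words R (D R k)"
  obtains \<theta> where "pattern A \<theta>"
    "\<And>z w k. range z \<subseteq> A \<Longrightarrow> range w \<subseteq> A \<Longrightarrow>
       meets (pairs (fill z \<circ> \<theta>) (fill w \<circ> \<theta>)) (D (pair_type A z w) k)"
proof -
  define ty where "ty n z w = Id_on A \<union> pairs z w ` {..<n::nat}" for n z w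
  define ev where "ev z w = map (\<lambda>c. (fill z c, fill w c))" for z w :: "nat \<Rightarrow> 'a"
  \<comment> \<open>A task \<open>(z, w, k)\<close> is fulfilled by \<open>s\<close> as soon as some prefix of \<open>s\<close> evaluates into the dense
    set; this persists when \<open>s\<close> is extended.\<close>
  define ok where "ok n = (\<lambda>(z, w, k) s. \<exists>u v. s = u @ v \<and> ev z w u \<in> D (ty n z w) k)" for n
  define B where "B n = A <+> {..<n::nat}" for n
  define I where "I n = (({..<n} \<rightarrow>\<^sub>E A) \<times> ({..<n} \<rightarrow>\<^sub>E A) \<times> {..<n})" for n :: nat
  have ok_append: "ok n i (s @ t)" if "ok n i s" for n i s t
    using that unfolding ok_def by (cases i) (simp, metis append.assoc)
  have one: "\<exists>t\<in>lists (B n). ok n i (s @ t)" if i: "i \<in> I n" and s: "s \<in> lists (B n)" for n i s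
  proof -
    obtain z w k where zw: "i = (z, w, k)" "z \<in> {..<n} \<rightarrow>\<^sub>E A" "w \<in> {..<n} \<rightarrow>\<^sub>E A"
      using i by (auto simp: I_def)
    have R: "Id_on A \<subseteq> ty n z w" "ty n z w \<subseteq> A \<times> A"
      using zw by (auto simp: ty_def pairs_def PiE_def Pi_def)
    have "ev z w s \<in> lists (ty n z w)" using s zw
    proof -
      have "(fill z c, fill w c) \<in> ty n z w" if "c \<in> B n" for c
        using that by (auto simp: B_def ty_def pairs_def)
      then show ?thesis using s by (auto simp: ev_def)
    qed
    then obtain r where r: "r \<in> lists (ty n z w)" "ev z w s @ r \<in> D (ty n z w) k"
      using D[OF R, of k] unfolding dense_words_def by metis
    obtain t where t: "t \<in> lists (B n)" "ev z w t = r"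
      using realise_letters[of r A z w n] r(1) by (auto simp: ty_def ev_def B_def)
    have "ev z w (s @ t) \<in> D (ty n z w) k" using r t by (simp add: ev_def)
    then have "ok n i (s @ t)" unfolding ok_def zw(1)
      by (simp, intro exI[of _ "s @ t"]) simp
    then show ?thesis using t by blast
  qed
  have "finite (I n)" for n using A by (auto simp: I_def intro!: finite_PiE)
  then have all: "\<exists>t\<in>lists (B n). \<forall>i\<in>I n. ok n i (s @ t)" if "s \<in> lists (B n)" for n s
    by (rule extend_finitely_many) (use that one ok_append in auto)
  define next_block where "next_block n s =
    (SOME t. t \<in> lists (B n) \<and> (\<forall>i\<in>I n. ok n i (s @ t)))" for n s
  have next_block: "next_block n s \<in> lists (B n)" "\<forall>i\<in>I n. ok n i (s @ next_block n s)"
    if "s \<in> lists (B n)" for n s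
    using someI_ex[of "\<lambda>t. t \<in> lists (B n) \<and> (\<forall>i\<in>I n. ok n i (s @ t))"] all[OF that]
    unfolding next_block_def by blast+
  define W where "W = rec_nat [] (\<lambda>n s. s @ Inr n # next_block (Suc n) (s @ [Inr n]))"
  have W_Suc: "W (Suc n) = (W n @ [Inr n]) @ next_block (Suc n) (W n @ [Inr n])" for n
    by (simp add: W_def)
  have B_Suc: "lists (B n) \<subseteq> lists (B (Suc n))" for n
    by (rule lists_mono) (auto simp: B_def)
  have W_lists': "W n @ [Inr n] \<in> lists (B (Suc n))" if "W n \<in> lists (B n)" for n
    using that B_Suc[of n] by (auto simp: B_def)
  have W_lists: "W n \<in> lists (B n)" for n
  proof (induction n)
    case 0
    then show ?case by (simp add: W_def)
  next
    case (Suc n)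
    then show ?case using next_block(1)[OF W_lists'[OF Suc]] W_lists'[OF Suc]
      unfolding W_Suc by (simp only: append_in_lists_conv)
  qed
  have W_ok: "ok (Suc n) i (W (Suc n))" if "i \<in> I (Suc n)" for n i
    using next_block(2)[OF W_lists'[OF W_lists]] that unfolding W_Suc by blast
  have W_len: "n \<le> length (W n)" for n
    by (induction n) (auto simp: W_Suc)
  have W_mono: "\<exists>t. W n = W m @ t" if "m \<le> n" for m n
    using that by (induction n rule: dec_induct) (auto simp: W_Suc)
  have W_nth: "W n ! k = W m ! k" if "k < length (W n)" "k < length (W m)" for m n k
  proof -
    have le: "W n ! k = W m ! k" if "m \<le> n" "k < length (W m)" for m n
      using W_mono[OF that(1)] that(2) by (auto simp: nth_append)
    show ?thesis using le[of m n] le[of n m] that by (cases "m \<le> n") auto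
  qed
  define \<theta> where "\<theta> k = W (Suc k) ! k" for k
  have \<theta>_W: "prefix (length (W n)) \<theta> = W n" for n
  proof (rule nth_equalityI)
    fix k assume "k < length (prefix (length (W n)) \<theta>)"
    then show "prefix (length (W n)) \<theta> ! k = W n ! k"
      using W_nth[of k "Suc k" n] W_len[of "Suc k"] by (simp add: \<theta>_def)
  qed simp
  have "\<theta> k \<in> A <+> UNIV" for k
  proof -
    have "\<theta> k \<in> set (W (Suc k))" using W_len[of "Suc k"] by (simp add: \<theta>_def)
    then have "\<theta> k \<in> A <+> {..<Suc k}" using W_lists[of "Suc k"] by (auto simp: B_def)
    then show ?thesis by (elim PlusE) auto
  qed
  moreover have "Inr n \<in> range \<theta>" for n
  proof -
    have "Inr n \<in> set (W (Suc n))" by (simp add: W_Suc)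
    then have "Inr n \<in> set (prefix (length (W (Suc n))) \<theta>)" by (simp only: \<theta>_W)
    then show ?thesis by auto
  qed
  ultimately have "pattern A \<theta>" by (auto simp: pattern_def)
  moreover have "meets (pairs (fill z \<circ> \<theta>) (fill w \<circ> \<theta>)) (D (pair_type A z w) k)"
    if zw: "range z \<subseteq> A" "range w \<subseteq> A" for z w k
  proof -
    have "finite (range (pairs z w))"
      by (rule finite_subset[of _ "A \<times> A"]) (use A zw in \<open>auto simp: pairs_def\<close>)
    then obtain C where C: "finite C" "range (pairs z w) = pairs z w ` C"
      by (metis finite_subset_image order_refl)
    define n where "n = max k (Max (insert 0 C))"
    have "C \<subseteq> {..<Suc n}" using C(1) by (auto simp: n_def less_Suc_eq_le max.coboundedI2)
    then have ty_n: "ty (Suc n) z w = pair_type A z w"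
      using C(2) by (auto simp: ty_def pair_type_def)
    \<comment> \<open>Tasks range over extensional functions, of which there are only finitely many.\<close>
    define z' where "z' = restrict z {..<Suc n}"
    define w' where "w' = restrict w {..<Suc n}"
    have "(z', w', k) \<in> I (Suc n)" using zw by (auto simp: I_def z'_def w'_def n_def)
    then have "ok (Suc n) (z', w', k) (W (Suc n))" by (rule W_ok)
    then obtain u v where uv: "W (Suc n) = u @ v" "ev z' w' u \<in> D (ty (Suc n) z' w') k"
      unfolding ok_def prod.case by (elim exE conjE)
    have "ty (Suc n) z' w' = ty (Suc n) z w"
      by (simp add: ty_def pairs_def z'_def w'_def cong: image_cong_simp)
    moreover have "ev z' w' u = ev z w u"
    proof -
      have "(fill z' c, fill w' c) = (fill z c, fill w c)" if "c \<in> set u" for c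
      proof -
        have "c \<in> B (Suc n)" using that W_lists[of "Suc n"] uv(1) by auto
        then show ?thesis unfolding B_def by (elim PlusE) (auto simp: z'_def w'_def)
      qed
      then show ?thesis unfolding ev_def by (intro map_cong) auto
    qed
    moreover have "prefix (length u) (pairs (fill z \<circ> \<theta>) (fill w \<circ> \<theta>)) = ev z w u"
    proof -
      have "prefix (length u) \<theta> = u"
        using arg_cong[OF \<theta>_W[of "Suc n"], of "take (length u)"] uv(1) by simp
      then have "ev z w u = ev z w (prefix (length u) \<theta>)" by simp
      then show ?thesis by (simp add: ev_def subsequence_def pairs_def)
    qed
    ultimately show ?thesis using uv(2) ty_n unfolding meets_def by metis
  qed
  ultimately show ?thesis using that by blast
qed

section \<open>Canonization along a pattern\<close>

definition pull :: "('a + nat) word \<Rightarrow> ('a word \<times> 'a word) set \<Rightarrow> ('a word \<times> 'a word) set" where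
  "pull \<theta> E = {(z, w). (fill z \<circ> \<theta>, fill w \<circ> \<theta>) \<in> E}"

text \<open>
  \<open>E\<close> contains the power \<open>Q\<^sup>\<omega>\<close>, pairs of words being read as words of pairs.
\<close>

definition contains_power :: "('a \<times> 'a) set \<Rightarrow> ('a word \<times> 'a word) set \<Rightarrow> bool" where
  "contains_power Q E \<longleftrightarrow> (\<forall>z w. range (pairs z w) \<subseteq> Q \<longrightarrow> (z, w) \<in> E)"

text \<open>
  Analyticity of \<open>E \<inter> (A\<^sup>\<omega> \<times> A\<^sup>\<omega>)\<close>.  Speaking of closed relations rather than continuous images
  makes the restriction to \<open>R\<^sup>\<omega>\<close> for \<open>R \<subseteq> A \<times> A\<close> immediate.
\<close>

definition suslin_rel :: "'a set \<Rightarrow> ('a word \<times> 'a word) set \<Rightarrow> bool" where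
  "suslin_rel A E \<longleftrightarrow> (\<exists>P. closed_rel (A \<times> A) P \<and>
     (\<forall>z w. range z \<subseteq> A \<longrightarrow> range w \<subseteq> A \<longrightarrow> ((z, w) \<in> E \<longleftrightarrow> (\<exists>b. P (pairs z w) b))))"

definition substitute :: "('a + nat) word \<Rightarrow> ('a + nat) word \<Rightarrow> ('a + nat) word" where
  "substitute \<eta> \<psi> = case_sum Inl \<eta> \<circ> \<psi>"

lemma fill_substitute: "fill z \<circ> substitute \<eta> \<psi> = fill (fill z \<circ> \<eta>) \<circ> \<psi>"
proof
  show "(fill z \<circ> substitute \<eta> \<psi>) k = (fill (fill z \<circ> \<eta>) \<circ> \<psi>) k" for k
    by (cases "\<psi> k") (simp_all add: substitute_def)
qed

lemma pull_substitute: "pull (substitute \<eta> \<psi>) E = pull \<eta> (pull \<psi> E)"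
  by (simp add: pull_def fill_substitute)

lemma pattern_substitute:
  assumes "pattern A \<eta>" "pattern A \<psi>"
  shows "pattern A (substitute \<eta> \<psi>)"
proof (rule patternI)
  show "a \<in> A" if "substitute \<eta> \<psi> k = Inl a" for k a
    using that pattern_letter[OF assms(1)] pattern_letter[OF assms(2), of k]
    by (cases "\<psi> k") (auto simp: substitute_def)
  show "\<exists>k. substitute \<eta> \<psi> k = Inr i" for i
  proof -
    obtain j where "\<eta> j = Inr i" using pattern_variable[OF assms(1)] by blast
    moreover obtain k where "\<psi> k = Inr j" using pattern_variable[OF assms(2)] by blast
    ultimately have "substitute \<eta> \<psi> k = Inr i" by (simp add: substitute_def)
    then show ?thesis by blast
  qed
qed

lemma sym_pull: "sym E \<Longrightarrow> sym (pull \<theta> E)"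
  by (auto simp: sym_def pull_def)

lemma trans_pull: "trans E \<Longrightarrow> trans (pull \<theta> E)"
  unfolding trans_def pull_def by blast

lemma contains_power_relcomp:
  assumes "trans E" "contains_power T E" "contains_power R E"
  shows "contains_power (T O R) E"
  unfolding contains_power_def
proof (intro allI impI)
  fix z w assume "range (pairs z w) \<subseteq> T O R"
  then have "\<exists>y. (z k, y) \<in> T \<and> (y, w k) \<in> R" for k
    by (auto simp: pairs_def subset_iff relcomp_unfold)
  then obtain y where "\<And>k. (z k, y k) \<in> T \<and> (y k, w k) \<in> R" by metis
  then have "range (pairs z y) \<subseteq> T" "range (pairs y w) \<subseteq> R" by (auto simp: pairs_def)
  then have "(z, y) \<in> E" "(y, w) \<in> E" using assms by (auto simp: contains_power_def)
  then show "(z, w) \<in> E" using assms(1) by (meson transD)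
qed

lemma contains_power_converse:
  assumes "sym E" "contains_power T E"
  shows "contains_power (T\<inverse>) E"
  unfolding contains_power_def
proof (intro allI impI)
  fix z w assume "range (pairs z w) \<subseteq> T\<inverse>"
  then have "range (pairs w z) \<subseteq> T" by (auto simp: pairs_def)
  then have "(w, z) \<in> E" using assms(2) by (auto simp: contains_power_def)
  then show "(z, w) \<in> E" using assms(1) by (rule symD[rotated])
qed

text \<open>
  Plugging words into a pattern adds only diagonal letter pairs, so the property survives
  every further substitution.
\<close>

lemma contains_power_pull:
  assumes "pattern A \<theta>" "Id_on A \<subseteq> Q" "Q \<subseteq> A \<times> A" "contains_power Q E"
  shows "contains_power Q (pull \<theta> E)"
  unfolding contains_power_def
proof (intro allI impI)
  fix z w assume zw: "range (pairs z w) \<subseteq> Q"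
  have "pair_type A (fill z \<circ> \<theta>) (fill w \<circ> \<theta>) = pair_type A z w"
    using pair_type_fill assms(1) range_pairs_subset(1)[OF zw assms(3)] .
  then have "range (pairs (fill z \<circ> \<theta>) (fill w \<circ> \<theta>)) \<subseteq> Q"
    using assms(2) zw unfolding pair_type_def by blast
  then show "(z, w) \<in> pull \<theta> E" using assms(4) by (simp add: contains_power_def pull_def)
qed

definition graph_words :: "('a word \<times> 'a word) set \<Rightarrow> ('a \<times> 'a) word set" where
  "graph_words E = {x. (fst \<circ> x, snd \<circ> x) \<in> E}"

lemma pairs_fst_snd: "pairs (fst \<circ> x) (snd \<circ> x) = x"
  by (simp add: pairs_def)

lemma pairs_in_graph_words: "pairs z w \<in> graph_words E \<longleftrightarrow> (z, w) \<in> E"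
  by (simp add: graph_words_def pairs_def comp_def)

lemma suslin_rel_category:
  assumes A: "finite A" and R: "R \<subseteq> A \<times> A" and E: "suslin_rel A E"
  shows "meager_below R [] (graph_words E) \<or> (\<exists>s\<in>lists R. meager_below R s (- graph_words E))"
proof -
  obtain P where P: "closed_rel (A \<times> A) P" "\<And>z w. range z \<subseteq> A \<Longrightarrow> range w \<subseteq> A \<Longrightarrow>
    (z, w) \<in> E \<longleftrightarrow> (\<exists>b. P (pairs z w) b)"
    using E unfolding suslin_rel_def by metis
  have "closed_rel R P" using P(1) R unfolding closed_rel_def by (meson order_trans)
  moreover have "finite R" using A R by (meson finite_SigmaI finite_subset)
  ultimately consider (meager) "meager_below R [] {x. \<exists>b. P x b}"
    | (comeager) s where "s \<in> lists R" "meager_below R s (- {x. \<exists>b. P x b})"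
    using projection_meager_or_comeager by blast
  note cases = this
  have eq: "x \<in> graph_words E \<longleftrightarrow> (\<exists>b. P x b)" if "range x \<subseteq> R" for x
  proof -
    have "range (fst \<circ> x) \<subseteq> A" "range (snd \<circ> x) \<subseteq> A"
      using range_pairs_subset[of "fst \<circ> x" "snd \<circ> x"] that R by (auto simp: pairs_fst_snd)
    then show ?thesis using P(2) by (simp add: graph_words_def pairs_fst_snd)
  qed
  from cases show ?thesis
  proof cases
    case meager
    then have "meager_below R [] (graph_words E)" by (rule meager_below_mono) (simp add: eq)
    then show ?thesis ..
  next
    case comeager
    from comeager(2) have "meager_below R s (- graph_words E)"
      by (rule meager_below_mono) (simp add: eq)
    then show ?thesis using comeager(1) by blast
  qed
qed

text \<open>
  Suppose that \<open>E\<close> is comeager in \<open>R\<^sup>\<omega>\<close> below \<open>s\<close>, and let \<open>u\<close> and \<open>v\<close> be the two components of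
  \<open>s\<close>.  By fusion there is a pattern \<open>\<theta>\<close> such that \<open>u \<frown> x\<close> and \<open>v \<frown> y\<close> are \<open>E\<close>-related whenever \<open>x\<close> and
  \<open>y\<close> belong to the cube of \<open>\<theta>\<close> and have type exactly \<open>R\<close>.  Giving the first variables of \<open>\<theta>\<close>
  the values \<open>p\<close> on the left and \<open>q\<close> on the right, where the pairs from \<open>p\<close> and \<open>q\<close> enumerate \<open>R\<close>,
  forces type \<open>R\<close> as soon as the remaining values are \<open>R\<close>-related.

  The left and the right word come from different patterns, though.  If \<open>z\<close> and \<open>w\<close> are
  \<open>R\<close>-related, then the left words of both \<open>z\<close> and \<open>w\<close> are \<open>E\<close>-related to the right word of
  \<open>w\<close>, by reflexivity of \<open>R\<close>; hence the left pattern alone works.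
\<close>

lemma comeager_contains_power:
  fixes A :: "'a set"
  assumes A: "finite A" and R: "Id_on A \<subseteq> R" "R \<subseteq> A \<times> A" and E: "sym E" "trans E"
    and s: "s \<in> lists R" and comeager: "meager_below R s (- graph_words E)"
  obtains \<eta> where "pattern A \<eta>" "contains_power R (pull \<eta> E)"
proof -
  obtain D where D: "\<And>k::nat. dense_words R (D k)" "\<And>x. range x \<subseteq> R \<Longrightarrow>
      prefix (length s) x = s \<Longrightarrow> \<forall>k. meets x (D k) \<Longrightarrow> x \<in> graph_words E"
    using comeager unfolding meager_below_def by auto
  define D' where "D' k = {r. \<exists>m. take m (s @ r) \<in> D k}" for k
  have D'_dense: "dense_words R (D' k)" for k
    unfolding dense_words_def
  proof
    fix r assume "r \<in> lists R"
    then have "s @ r \<in> lists R" using s by simp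
    then obtain t where t: "t \<in> lists R" "(s @ r) @ t \<in> D k"
      using D(1) unfolding dense_words_def by metis
    then have "take (length (s @ r @ t)) (s @ r @ t) \<in> D k" by simp
    then show "\<exists>t\<in>lists R. r @ t \<in> D' k" using t(1) unfolding D'_def by blast
  qed
  have D'_meets: "meets (s \<frown> y) (D k)" if y: "meets y (D' k)" for y k
  proof -
    obtain n m where "take m (s @ prefix n y) \<in> D k" using y by (auto simp: meets_def D'_def simp del: take_append)
    moreover have "s @ prefix n y = prefix (length s + n) (s \<frown> y)" by simp
    ultimately have "prefix (min m (length s + n)) (s \<frown> y) \<in> D k"
      by (metis subsequence_take add_0)
    then show ?thesis by (auto simp: meets_def)
  qed
  obtain \<theta> where \<theta>: "pattern A \<theta>" "\<And>z w k. range z \<subseteq> A \<Longrightarrow> range w \<subseteq> A \<Longrightarrow>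
       meets (pairs (fill z \<circ> \<theta>) (fill w \<circ> \<theta>)) ((if pair_type A z w = R then D' k else UNIV))"
    by (rule fusion[OF A, of "\<lambda>R' k. if R' = R then D' k else UNIV"])
      (use D'_dense in \<open>auto simp: dense_words_def\<close>)
  have "finite R" using A R(2) by (meson finite_SigmaI finite_subset)
  then obtain rl where rl: "set rl = R" using finite_list by blast
  define p where "p = map fst rl"
  define q where "q = map snd rl"
  define u where "u = map fst s"
  define v where "v = map snd s"
  define extend where "extend l = substitute (map Inl l \<frown> Inr) \<theta>" for l :: "'a list"
  have fill_extend: "fill z \<circ> extend l = fill (l \<frown> z) \<circ> \<theta>" for l z
    unfolding extend_def fill_substitute by simp
  define \<eta> where "\<eta> = map Inl u \<frown> extend p"
  have fill_\<eta>: "fill z \<circ> \<eta> = u \<frown> (fill (p \<frown> z) \<circ> \<theta>)" for z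
    by (simp add: \<eta>_def fill_extend)
  have pq: "set p \<subseteq> A" "set q \<subseteq> A" "set u \<subseteq> A"
    using rl R(2) s by (auto simp: p_def q_def u_def)
  have cross: "(u \<frown> (fill (p \<frown> z) \<circ> \<theta>), v \<frown> (fill (q \<frown> w) \<circ> \<theta>)) \<in> E"
    if zw: "range (pairs z w) \<subseteq> R" for z w
  proof -
    note A_zw = range_pairs_subset[OF zw R(2)]
    have "pairs (p \<frown> z) (q \<frown> w) = rl \<frown> pairs z w"
      by (simp add: pairs_conc p_def q_def zip_map_fst_snd)
    then have ty: "pair_type A (p \<frown> z) (q \<frown> w) = R"
      using R(1) rl zw by (auto simp: pair_type_def)
    let ?y = "pairs (fill (p \<frown> z) \<circ> \<theta>) (fill (q \<frown> w) \<circ> \<theta>)"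
    have x: "pairs (u \<frown> (fill (p \<frown> z) \<circ> \<theta>)) (v \<frown> (fill (q \<frown> w) \<circ> \<theta>)) = s \<frown> ?y"
      by (simp add: pairs_conc u_def v_def zip_map_fst_snd)
    have p_z: "range (p \<frown> z) \<subseteq> A" "range (q \<frown> w) \<subseteq> A" using pq A_zw by auto
    have "range ?y \<subseteq> R"
      using pair_type_fill[OF \<theta>(1) p_z(1), of "q \<frown> w"] ty unfolding pair_type_def by blast
    then have "range (s \<frown> ?y) \<subseteq> R" using s by auto
    moreover have "\<forall>k. meets (s \<frown> ?y) (D k)"
      using \<theta>(2)[OF p_z] D'_meets by (simp add: ty)
    ultimately have "s \<frown> ?y \<in> graph_words E" using D(2) by simp
    then show ?thesis by (simp add: pairs_in_graph_words flip: x)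
  qed
  have "contains_power R (pull \<eta> E)"
    unfolding contains_power_def
  proof (intro allI impI)
    fix z w assume zw: "range (pairs z w) \<subseteq> R"
    have "range (pairs w w) \<subseteq> R"
      using range_pairs_subset(2)[OF zw R(2)] R(1) by (auto simp: pairs_def)
    then show "(z, w) \<in> pull \<eta> E"
      using cross[OF zw] cross[of w w] E unfolding pull_def fill_\<eta>
      by (auto dest: symD intro: transD)
  qed
  moreover have "pattern A \<eta>"
  proof (rule patternI)
    have ext: "pattern A (extend p)"
      unfolding extend_def
    proof (rule patternI)
      fix k a assume "substitute (map Inl p \<frown> Inr) \<theta> k = Inl a"
      then consider "\<theta> k = Inl a" | j where "(map Inl p \<frown> Inr) j = Inl a"
        by (cases "\<theta> k") (auto simp: substitute_def)
      then show "a \<in> A"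
      proof cases
        case 1
        then show ?thesis using pattern_letter[OF \<theta>(1)] by blast
      next
        case 2
        then have "j < length p \<and> a = p ! j" by (cases "j < length p") auto
        then show ?thesis using pq(1) by auto
      qed
    next
      fix i
      obtain k where "\<theta> k = Inr (length p + i)" using pattern_variable[OF \<theta>(1)] by blast
      then have "substitute (map Inl p \<frown> Inr) \<theta> k = Inr i" by (simp add: substitute_def)
      then show "\<exists>k. substitute (map Inl p \<frown> Inr) \<theta> k = Inr i" by blast
    qed
    show "a \<in> A" if "\<eta> k = Inl a" for k a
      using that pattern_letter[OF ext] pq(3) by (cases "k < length u") (auto simp: \<eta>_def)
    show "\<exists>k. \<eta> k = Inr i" for i
    proof -
      obtain k where "extend p k = Inr i" using pattern_variable[OF ext] by blast
      then have "\<eta> (length u + k) = Inr i" by (simp add: \<eta>_def)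
      then show ?thesis by blast
    qed
  qed
  ultimately show ?thesis using that by blast
qed

text \<open>
  The heart of the matter: a maximal \<open>Q\<close> absorbs all \<open>R\<close> for which \<open>E\<close> is not meager in \<open>R\<^sup>\<omega>\<close>,
  and fusion then avoids \<open>E\<close> for all pairs whose type is not contained in \<open>Q\<close>.
\<close>

theorem canonical_pattern:
  fixes A :: "'a set"
  assumes A: "finite A" and E: "sym E" "trans E"
    and refl: "\<And>z. range z \<subseteq> A \<Longrightarrow> (z, z) \<in> E"
    and suslin: "\<And>\<psi>. pattern A \<psi> \<Longrightarrow> suslin_rel A (pull \<psi> E)"
  obtains \<eta> Q where "pattern A \<eta>" "equiv A Q"
    "\<And>z w. range z \<subseteq> A \<Longrightarrow> range w \<subseteq> A \<Longrightarrow>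
       (z, w) \<in> pull \<eta> E \<longleftrightarrow> range (pairs z w) \<subseteq> Q"
proof -
  define good where "good Q \<longleftrightarrow> Id_on A \<subseteq> Q \<and> Q \<subseteq> A \<times> A \<and>
    (\<exists>\<psi>. pattern A \<psi> \<and> contains_power Q (pull \<psi> E))" for Q
  have "contains_power (Id_on A) (pull Inr E)"
    unfolding contains_power_def
  proof (intro allI impI)
    fix z w :: "'a word" assume zw: "range (pairs z w) \<subseteq> Id_on A"
    then have Id: "pairs z w k \<in> Id_on A" for k by blast
    have "z k = w k" "z k \<in> A" for k using Id[of k] by (auto simp: pairs_def)
    then have "z = w" "range z \<subseteq> A" by blast+
    then show "(z, w) \<in> pull Inr E" using refl by (simp add: pull_def comp_def)
  qed
  then have "good (Id_on A)" using pattern_Inr unfolding good_def by blast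
  moreover have "finite {Q. good Q}"
    by (rule finite_subset[of _ "Pow (A \<times> A)"]) (auto simp: good_def A)
  ultimately obtain Q where "good Q" and max: "\<And>Q'. good Q' \<Longrightarrow> Q \<subseteq> Q' \<Longrightarrow> Q' = Q"
    using finite_has_maximal[of "{Q. good Q}"] by (metis empty_iff mem_Collect_eq)
  then obtain \<psi> where Q: "Id_on A \<subseteq> Q" "Q \<subseteq> A \<times> A" and \<psi>: "pattern A \<psi>"
    and power: "contains_power Q (pull \<psi> E)"
    unfolding good_def by blast
  define F where "F = pull \<psi> E"
  have F: "sym F" "trans F" using E by (simp_all add: F_def sym_pull trans_pull)
  \<comment> \<open>If \<open>R\<close> were not contained in \<open>Q\<close>, then \<open>Q O R\<close> would contradict the maximality of \<open>Q\<close>: it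
    contains both relations, as they are reflexive.\<close>
  have absorb: "R \<subseteq> Q" if R: "Id_on A \<subseteq> R" "R \<subseteq> A \<times> A"
    and \<eta>: "pattern A \<eta>" "contains_power R (pull \<eta> F)" for R \<eta>
  proof -
    have "contains_power Q (pull \<eta> F)"
      using contains_power_pull[OF \<eta>(1) Q] power by (simp add: F_def)
    then have "contains_power (Q O R) (pull \<eta> F)"
      using contains_power_relcomp \<eta>(2) trans_pull F(2) by blast
    moreover have sub: "Q \<subseteq> Q O R" "R \<subseteq> Q O R" "Q O R \<subseteq> A \<times> A"
      using Q R by blast+
    ultimately have "good (Q O R)"
      unfolding good_def F_def
      using Q(1) pattern_substitute[OF \<eta>(1) \<psi>] by (metis order_trans pull_substitute)
    then show ?thesis using max sub by blast
  qed
  have F_Inr: "pull Inr F = F" by (simp add: pull_def comp_def)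
  have "Q\<inverse> \<subseteq> Q"
  proof (rule absorb[OF _ _ pattern_Inr])
    show "Id_on A \<subseteq> Q\<inverse>" "Q\<inverse> \<subseteq> A \<times> A" using Q by auto
    show "contains_power (Q\<inverse>) (pull Inr F)"
      unfolding F_Inr using contains_power_converse[OF F(1)] power by (simp add: F_def)
  qed
  moreover have "Q O Q \<subseteq> Q"
  proof (rule absorb[OF _ _ pattern_Inr])
    show "Id_on A \<subseteq> Q O Q" using Q(1) by blast
    show "Q O Q \<subseteq> A \<times> A" using Q(2) by blast
    show "contains_power (Q O Q) (pull Inr F)"
      unfolding F_Inr using contains_power_relcomp[OF F(2)] power by (simp add: F_def)
  qed
  ultimately have "equiv A Q"
    using Q by (intro equivI refl_onI symI transI) blast+
  have "\<exists>D. \<forall>k::nat. dense_words R (D k) \<and> (\<not> R \<subseteq> Q \<longrightarrow> (\<forall>x. range x \<subseteq> R \<longrightarrow>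
      (\<forall>k. meets x (D k)) \<longrightarrow> x \<notin> graph_words F))"
    if R: "Id_on A \<subseteq> R" "R \<subseteq> A \<times> A" for R
  proof (cases "R \<subseteq> Q")
    case True
    then show ?thesis by (intro exI[of _ "\<lambda>_. UNIV"]) (auto simp: dense_words_def)
  next
    case False
    have "\<not> meager_below R s (- graph_words F)" if "s \<in> lists R" for s
      using comeager_contains_power[OF A R F that] absorb[OF R] False by metis
    then have "meager_below R [] (graph_words F)"
      using suslin_rel_category[OF A R(2) suslin[OF \<psi>]] F_def by blast
    then show ?thesis unfolding meager_below_def by auto
  qed
  then obtain D where D: "\<And>R k::nat. Id_on A \<subseteq> R \<Longrightarrow> R \<subseteq> A \<times> A \<Longrightarrow> dense_words R (D R k)"
    "\<And>R x. Id_on A \<subseteq> R \<Longrightarrow> R \<subseteq> A \<times> A \<Longrightarrow> \<not> R \<subseteq> Q \<Longrightarrow> range x \<subseteq> R \<Longrightarrow>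
       \<forall>k. meets x (D R k) \<Longrightarrow> x \<notin> graph_words F"
    by metis
  obtain \<theta> where \<theta>: "pattern A \<theta>" "\<And>z w k. range z \<subseteq> A \<Longrightarrow> range w \<subseteq> A \<Longrightarrow>
       meets (pairs (fill z \<circ> \<theta>) (fill w \<circ> \<theta>)) (D (pair_type A z w) k)"
    using fusion[OF A, of D] D(1) by blast
  have "(z, w) \<in> pull \<theta> F \<longleftrightarrow> range (pairs z w) \<subseteq> Q" if zw: "range z \<subseteq> A" "range w \<subseteq> A" for z w
  proof
    assume "range (pairs z w) \<subseteq> Q"
    then show "(z, w) \<in> pull \<theta> F"
      using contains_power_pull[OF \<theta>(1) Q] power unfolding F_def contains_power_def by blast
  next
    assume "(z, w) \<in> pull \<theta> F"
    then have "pairs (fill z \<circ> \<theta>) (fill w \<circ> \<theta>) \<in> graph_words F"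
      by (simp add: pairs_in_graph_words pull_def)
    moreover have "range (pairs (fill z \<circ> \<theta>) (fill w \<circ> \<theta>)) \<subseteq> pair_type A z w"
      using pair_type_fill[OF \<theta>(1) zw(1), of w] unfolding pair_type_def by blast
    moreover have "Id_on A \<subseteq> pair_type A z w" "pair_type A z w \<subseteq> A \<times> A"
      using zw by (auto simp: pair_type_def pairs_def)
    ultimately have "pair_type A z w \<subseteq> Q" using D(2) \<theta>(2)[OF zw] by blast
    then show "range (pairs z w) \<subseteq> Q" unfolding pair_type_def by blast
  qed
  then show ?thesis
    using that[OF pattern_substitute[OF \<theta>(1) \<psi>] \<open>equiv A Q\<close>] by (simp add: F_def pull_substitute)
qed

section \<open>Partitions as patterns\<close>

lemma Inl_Inr_in_Plus [simp]:
  "Inl a \<in> A <+> B \<longleftrightarrow> a \<in> A" "Inr b \<in> A <+> B \<longleftrightarrow> b \<in> B"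
  by auto

definition fibres :: "'b set \<Rightarrow> ('b \<Rightarrow> 'c) \<Rightarrow> 'b set set" where
  "fibres U c = (\<lambda>p. {q \<in> U. c q = c p}) ` U"

lemma partition_on_fibres: "partition_on U (fibres U c)"
  by (rule partition_onI) (auto simp: fibres_def disjnt_def)

lemma fibresE:
  assumes "P \<in> fibres U c"
  obtains p where "p \<in> U" "P = {q \<in> U. c q = c p}"
  using assms by (auto simp: fibres_def)

lemma same_fibre_iff:
  "(\<exists>P\<in>fibres U c. p \<in> P \<and> q \<in> P) \<longleftrightarrow> p \<in> U \<and> q \<in> U \<and> c p = c q"
  by (auto simp: fibres_def)

text \<open>
  A partition is determined by the relation of lying in a common piece.
\<close>

lemma fibres_eqI:
  assumes "partition_on U X"
    and "\<And>p q. p \<in> U \<Longrightarrow> q \<in> U \<Longrightarrow> (\<exists>P\<in>X. p \<in> P \<and> q \<in> P) \<longleftrightarrow> c p = c q"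
  shows "fibres U c = X"
proof -
  have "(\<exists>P\<in>fibres U c. p \<in> P \<and> q \<in> P) \<longleftrightarrow> (\<exists>P\<in>X. p \<in> P \<and> q \<in> P)" for p q
  proof -
    have "p \<in> U \<and> q \<in> U" if "\<exists>P\<in>X. p \<in> P \<and> q \<in> P"
      using that assms(1) unfolding partition_on_def by blast
    then show ?thesis unfolding same_fibre_iff using assms(2) by blast
  qed
  then have "{(p, q). \<exists>P\<in>fibres U c. p \<in> P \<and> q \<in> P} = {(p, q). \<exists>P\<in>X. p \<in> P \<and> q \<in> P}"
    by (simp only:)
  then show ?thesis
    using partition_on_eq_quotient[OF partition_on_fibres, of U c]
      partition_on_eq_quotient[OF assms(1)] by metis
qed

lemma refines_fibres_iff:
  "refines U (fibres U c) (fibres U d) \<longleftrightarrow> (\<forall>p\<in>U. \<forall>q\<in>U. c p = c q \<longrightarrow> d p = d q)"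
  (is "?L \<longleftrightarrow> ?R")
proof
  assume ?L
  then have sub: "\<forall>P\<in>fibres U c. \<exists>Q\<in>fibres U d. P \<subseteq> Q" by (simp add: refines_def)
  show ?R
  proof (intro ballI impI)
    fix p q assume "p \<in> U" "q \<in> U" "c p = c q"
    then have "\<exists>P\<in>fibres U c. p \<in> P \<and> q \<in> P" by (simp add: same_fibre_iff)
    then obtain P where P: "P \<in> fibres U c" "p \<in> P" "q \<in> P" by blast
    then obtain Q where "Q \<in> fibres U d" "P \<subseteq> Q" using sub by blast
    then have "\<exists>Q\<in>fibres U d. p \<in> Q \<and> q \<in> Q" using P by blast
    then show "d p = d q" by (simp add: same_fibre_iff)
  qed
next
  assume R: ?R
  have "\<exists>Q\<in>fibres U d. P \<subseteq> Q" if P: "P \<in> fibres U c" for P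
  proof -
    obtain p where p: "p \<in> U" "P = {q \<in> U. c q = c p}" using P by (rule fibresE)
    have "P \<subseteq> {q \<in> U. d q = d p}" using R p by blast
    then show ?thesis using p(1) unfolding fibres_def by blast
  qed
  then show ?L unfolding refines_def by (simp add: partition_on_fibres)
qed

text \<open>
  The labelling \<open>case_sum Inl \<theta>\<close> gives each letter its own label and the position \<open>k\<close> the label
  \<open>\<theta> k\<close>; the partition consists of the points with equal labels.  Reading a word \<open>y\<close> as the
  pattern \<open>Inl \<circ> y\<close> without variables covers the members of \<open>parts A 0\<close> as well.
\<close>

definition partition_of :: "'a set \<Rightarrow> ('a + nat) word \<Rightarrow> ('a + nat) set set" where
  "partition_of A \<theta> = fibres (A <+> UNIV) (case_sum Inl \<theta>)"

lemma letters_separated: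
  assumes "P \<in> partition_of A \<theta>" "Inl a \<in> P" "Inl b \<in> P"
  shows "a = b"
proof -
  have "\<exists>P\<in>partition_of A \<theta>. Inl a \<in> P \<and> Inl b \<in> P" using assms by blast
  then show ?thesis unfolding partition_of_def same_fibre_iff by simp
qed

lemma partition_of_in_parts:
  assumes "pattern A \<theta>"
  shows "partition_of A \<theta> \<in> parts A \<infinity>"
proof -
  define V where "V i = {p \<in> A <+> UNIV. case_sum Inl \<theta> p = Inr i}" for i
  obtain \<kappa> where \<kappa>: "\<And>i. \<theta> (\<kappa> i) = Inr i" using pattern_positions[OF assms] by blast
  have "V i \<in> free_blocks A (partition_of A \<theta>)" for i
  proof -
    have "V i = {p \<in> A <+> UNIV. case_sum Inl \<theta> p = case_sum Inl \<theta> (Inr (\<kappa> i))}"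
      by (simp add: V_def \<kappa>)
    moreover have "Inr (\<kappa> i) \<in> A <+> UNIV" by simp
    ultimately have "V i \<in> partition_of A \<theta>"
      unfolding partition_of_def fibres_def by (rule image_eqI)
    moreover have "V i \<inter> Inl ` A = {}" by (auto simp: V_def)
    ultimately show ?thesis by (simp add: free_blocks_def)
  qed
  moreover have "inj V"
  proof (rule injI)
    fix i j assume "V i = V j"
    moreover have "Inr (\<kappa> i) \<in> V i" by (simp add: V_def \<kappa>)
    ultimately have "Inr (\<kappa> i) \<in> V j" by simp
    then show "i = j" by (simp add: V_def \<kappa>)
  qed
  ultimately have inf: "infinite (free_blocks A (partition_of A \<theta>))"
    using infinite_super[of "range V"] range_inj_infinite by blast
  have "partition_on (A <+> UNIV) (partition_of A \<theta>)"
    unfolding partition_of_def by (rule partition_on_fibres)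
  then show ?thesis using inf letters_separated[of _ A \<theta>] unfolding parts_def by auto
qed

lemma partition_of_word_in_parts:
  fixes A :: "'a set"
  assumes "range y \<subseteq> A"
  shows "partition_of A (Inl \<circ> y) \<in> parts A 0"
proof -
  have "P \<inter> Inl ` A \<noteq> {}" if P: "P \<in> partition_of A (Inl \<circ> y)" for P
  proof -
    define c :: "'a + nat \<Rightarrow> 'a + nat" where "c = case_sum Inl (Inl \<circ> y)"
    obtain p where p: "p \<in> A <+> UNIV" "P = {q \<in> A <+> UNIV. c q = c p}"
      using P unfolding partition_of_def c_def[symmetric] by (rule fibresE)
    obtain a where a: "a \<in> A" "c p = Inl a"
      using p(1) assms by (cases p) (auto simp: c_def)
    then have "c (Inl a) = c p" by (simp add: c_def)
    then have "Inl a \<in> P" "a \<in> A" using a(1) by (simp_all add: p(2))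
    then show ?thesis by blast
  qed
  then have free: "free_blocks A (partition_of A (Inl \<circ> y)) = {}" by (auto simp: free_blocks_def)
  have "partition_on (A <+> UNIV) (partition_of A (Inl \<circ> y))"
    unfolding partition_of_def by (rule partition_on_fibres)
  then show ?thesis
    using free letters_separated[of _ A "Inl \<circ> y"] unfolding parts_def zero_enat_def by auto
qed

text \<open>
  Conversely, a partition is recovered from the labelling of its classes by their letter or,
  if they are free, by their number in an enumeration of the countably many free blocks.
  The two implications at the end specialise this to \<open>parts A \<infinity>\<close> and to \<open>parts A 0\<close>.
\<close>

lemma partition_is_partition_of:
  fixes X :: "('a + nat) set set"
  assumes A: "finite A" and X: "partition_on (A <+> UNIV) X"
    and sep: "\<forall>a\<in>A. \<forall>b\<in>A. a \<noteq> b \<longrightarrow> (\<forall>P\<in>X. \<not> (Inl a \<in> P \<and> Inl b \<in> P))"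
  shows "\<exists>\<theta>. partition_of A \<theta> = X \<and> range \<theta> \<subseteq> A <+> UNIV \<and>
    (infinite (free_blocks A X) \<longrightarrow> range Inr \<subseteq> range \<theta>) \<and>
    (free_blocks A X = {} \<longrightarrow> (\<exists>y. range y \<subseteq> A \<and> \<theta> = Inl \<circ> y))"
proof -
  define U where "U = A <+> (UNIV :: nat set)"
  define r where "r = {(p, q). \<exists>P\<in>X. p \<in> P \<and> q \<in> P}"
  have r: "equiv U r" using equiv_partition_on[OF X] by (simp add: r_def U_def)
  have quot: "U // r = X" using partition_on_eq_quotient[OF X] by (simp add: r_def U_def)
  have "countable U" using A by (auto simp: U_def Plus_def countable_finite)
  then have "countable X" unfolding quot[symmetric] quotient_def by simp
  define F where "F = free_blocks A X"
  have F: "countable F"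
    by (rule countable_subset[OF _ \<open>countable X\<close>]) (auto simp: F_def free_blocks_def)
  define label where "label C =
    (if C \<in> F then Inr (to_nat_on F C) else Inl (SOME a. a \<in> A \<and> Inl a \<in> C))" for C
  define cls where "cls p = r `` {p}" for p
  have cls_X: "cls p \<in> X" if "p \<in> U" for p
    using that quot by (auto simp: cls_def quotient_def)
  have cls_self: "p \<in> cls p" if "p \<in> U" for p
    using that r by (auto simp: cls_def equiv_def refl_on_def)
  have cls_eq: "cls p = cls q \<longleftrightarrow> (p, q) \<in> r" if "p \<in> U" "q \<in> U" for p q
    using eq_equiv_class_iff[OF r that] by (simp add: cls_def)
  have label_bound: "\<exists>a. label (cls p) = Inl a \<and> a \<in> A \<and> Inl a \<in> cls p"
    if p: "p \<in> U" "cls p \<notin> F" for p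
  proof -
    have "cls p \<inter> Inl ` A \<noteq> {}" using p cls_X by (auto simp: F_def free_blocks_def)
    then have "\<exists>a. a \<in> A \<and> Inl a \<in> cls p" by blast
    from someI_ex[OF this] show ?thesis using p(2) by (simp add: label_def)
  qed
  have label_inj: "cls p = cls q" if pq: "p \<in> U" "q \<in> U" "label (cls p) = label (cls q)" for p q
  proof (cases "cls p \<in> F \<and> cls q \<in> F")
    case True
    then show ?thesis using pq(3) F by (simp add: label_def)
  next
    case False
    then have "cls p \<notin> F" "cls q \<notin> F"
      using pq(3) by (auto simp: label_def split: if_splits)
    then obtain a where a: "a \<in> A" "Inl a \<in> cls p" "Inl a \<in> cls q"
      using label_bound pq by (metis Inl_inject)
    then have "Inl a \<in> U" "(p, Inl a) \<in> r" "(q, Inl a) \<in> r" by (auto simp: U_def cls_def)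
    then have "cls p = cls (Inl a)" "cls q = cls (Inl a)"
      using pq by (simp_all add: cls_eq)
    then show ?thesis by simp
  qed
  have label_Inl: "label (cls (Inl a)) = Inl a" if "a \<in> A" for a
  proof -
    have a: "Inl a \<in> U" using that by (simp add: U_def)
    have "cls (Inl a) \<notin> F" using cls_self[OF a] \<open>a \<in> A\<close> by (auto simp: F_def free_blocks_def)
    then obtain b where "label (cls (Inl a)) = Inl b" "b \<in> A" "Inl b \<in> cls (Inl a)"
      using label_bound[OF a] by blast
    then show ?thesis using sep \<open>a \<in> A\<close> cls_X[OF a] cls_self[OF a] by metis
  qed
  define \<theta> where "\<theta> k = label (cls (Inr k))" for k
  have \<theta>_label: "case_sum Inl \<theta> p = label (cls p)" if "p \<in> U" for p
    using that label_Inl by (cases p) (auto simp: \<theta>_def U_def)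
  have Inr_U: "Inr k \<in> U" for k by (simp add: U_def)
  have "partition_of A \<theta> = X"
    unfolding partition_of_def
  proof (rule fibres_eqI[OF X])
    fix p q :: "'a + nat" assume "p \<in> A <+> UNIV" "q \<in> A <+> UNIV"
    then have pq: "p \<in> U" "q \<in> U" by (simp_all only: U_def)
    have "(\<exists>P\<in>X. p \<in> P \<and> q \<in> P) \<longleftrightarrow> cls p = cls q" using cls_eq[OF pq] by (simp add: r_def)
    also have "\<dots> \<longleftrightarrow> label (cls p) = label (cls q)" using label_inj[OF pq] by metis
    finally show "(\<exists>P\<in>X. p \<in> P \<and> q \<in> P) \<longleftrightarrow> case_sum Inl \<theta> p = case_sum Inl \<theta> q"
      by (simp add: \<theta>_label pq)
  qed
  moreover have "range \<theta> \<subseteq> A <+> UNIV"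
  proof (rule image_subsetI)
    fix k show "\<theta> k \<in> A <+> UNIV"
  proof (cases "cls (Inr k) \<in> F")
    case True
    then show ?thesis by (simp add: \<theta>_def label_def)
  next
    case False
    then obtain a where "\<theta> k = Inl a" "a \<in> A" using label_bound[OF Inr_U[of k]] \<theta>_def by metis
    then show ?thesis by simp
  qed
  qed
  moreover have "range Inr \<subseteq> range \<theta>" if "infinite (free_blocks A X)"
  proof
    fix c assume "c \<in> range (Inr :: nat \<Rightarrow> 'a + nat)"
    then obtain i where i: "c = Inr i" by blast
    obtain C where C: "C \<in> F" "to_nat_on F C = i"
      using to_nat_on_surj[OF F] \<open>infinite _\<close> unfolding F_def by blast
    then have "C \<in> U // r" by (simp add: quot F_def free_blocks_def)
    then obtain p where p: "p \<in> U" "C = cls p" by (auto simp: quotient_def cls_def)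
    have "p \<notin> Inl ` A" using C(1) cls_self[OF p(1)] unfolding F_def free_blocks_def p(2) by blast
    then obtain k where "p = Inr k" using p(1) by (cases p) (auto simp: U_def)
    then have "\<theta> k = c" using C p(2) by (simp add: \<theta>_def label_def i)
    then show "c \<in> range \<theta>" by blast
  qed
  moreover have "\<exists>y. range y \<subseteq> A \<and> \<theta> = Inl \<circ> y" if "free_blocks A X = {}"
  proof -
    have "\<exists>a. \<theta> k = Inl a \<and> a \<in> A" for k
      using label_bound[OF Inr_U[of k]] that by (auto simp: \<theta>_def F_def)
    then obtain y where "\<And>k. \<theta> k = Inl (y k) \<and> y k \<in> A" by metis
    then show ?thesis by (intro exI[of _ y]) auto
  qed
  ultimately show ?thesis by blast
qed

lemma pattern_of_parts:
  assumes "finite A" "X \<in> parts A \<infinity>"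
  obtains \<theta> where "pattern A \<theta>" "partition_of A \<theta> = X"
proof -
  have X: "partition_on (A <+> UNIV) X" "infinite (free_blocks A X)"
    "\<forall>a\<in>A. \<forall>b\<in>A. a \<noteq> b \<longrightarrow> (\<forall>P\<in>X. \<not> (Inl a \<in> P \<and> Inl b \<in> P))"
    using assms(2) by (simp_all add: parts_def)
  show ?thesis
    using partition_is_partition_of[OF assms(1) X(1,3)] X(2) that unfolding pattern_def by blast
qed

lemma word_of_parts_0:
  assumes "finite A" "x \<in> parts A 0"
  obtains y where "range y \<subseteq> A" "partition_of A (Inl \<circ> y) = x"
proof -
  have x: "partition_on (A <+> UNIV) x" "free_blocks A x = {}"
    "\<forall>a\<in>A. \<forall>b\<in>A. a \<noteq> b \<longrightarrow> (\<forall>P\<in>x. \<not> (Inl a \<in> P \<and> Inl b \<in> P))"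
    using assms(2) by (auto simp: parts_def zero_enat_def)
  show ?thesis
    using partition_is_partition_of[OF assms(1) x(1,3)] x(2) that by blast
qed

lemma word_of_partition_of:
  assumes "range y \<subseteq> A"
  shows "word_of A (partition_of A (Inl \<circ> y)) = y"
proof
  fix k
  have "(\<exists>P\<in>partition_of A (Inl \<circ> y). Inl a \<in> P \<and> Inr k \<in> P) \<longleftrightarrow> a = y k" if "a \<in> A" for a
    using that unfolding partition_of_def same_fibre_iff by simp
  moreover have "y k \<in> A" using assms by blast
  ultimately show "word_of A (partition_of A (Inl \<circ> y)) k = y k"
    unfolding word_of_def by (intro the_equality) auto
qed

lemma coarser_partition_of_iff:
  "coarser A (partition_of A \<theta>') (partition_of A \<theta>) \<longleftrightarrow>
     (\<forall>p\<in>A <+> UNIV. \<forall>q\<in>A <+> UNIV.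
        case_sum Inl \<theta> p = case_sum Inl \<theta> q \<longrightarrow> case_sum Inl \<theta>' p = case_sum Inl \<theta>' q)"
  unfolding coarser_def partition_of_def by (rule refines_fibres_iff)

lemma coarser_substitute: "coarser A (partition_of A (substitute \<eta> \<theta>)) (partition_of A \<theta>)"
proof -
  have "case_sum Inl (substitute \<eta> \<theta>) p = case_sum Inl \<eta> (case_sum Inl \<theta> p)" for p
    by (cases p) (simp_all add: substitute_def)
  then show ?thesis by (simp add: coarser_partition_of_iff)
qed

text \<open>
  A word below the partition of \<open>\<theta>\<close> is constant on the positions of each variable, so it is
  recovered by filling in its value at one position \<open>\<kappa> i\<close> for each variable \<open>Inr i\<close>.  Conversely,
  filling in \<open>z\<close> is the substitution of the pattern \<open>Inl \<circ> z\<close>.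
\<close>

lemma cube_partition_of:
  fixes A :: "'a set"
  assumes "finite A" "pattern A \<theta>"
  shows "cube A (partition_of A \<theta>) = {fill z \<circ> \<theta> |z. range z \<subseteq> A}"
proof (intro equalityI subsetI)
  fix v assume "v \<in> cube A (partition_of A \<theta>)"
  then obtain x where x: "x \<in> parts A 0" "coarser A x (partition_of A \<theta>)" "v = word_of A x"
    by (auto simp: cube_def)
  obtain y where y: "range y \<subseteq> A" "partition_of A (Inl \<circ> y) = x"
    using word_of_parts_0[OF assms(1) x(1)] .
  have v: "v = y" using word_of_partition_of[OF y(1)] by (simp add: x(3) y(2))
  have eq: "case_sum Inl (Inl \<circ> y) p = (case_sum Inl (Inl \<circ> y) q :: 'a + nat)"
    if "p \<in> A <+> UNIV" "q \<in> A <+> UNIV" "case_sum Inl \<theta> p = case_sum Inl \<theta> q" for p q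
    using x(2)[folded y(2), unfolded coarser_partition_of_iff, rule_format, OF that] .
  obtain \<kappa> where \<kappa>: "\<And>i. \<theta> (\<kappa> i) = Inr i" using pattern_positions[OF assms(2)] by blast
  have "y k = (fill (y \<circ> \<kappa>) \<circ> \<theta>) k" for k
  proof (cases "\<theta> k")
    case (Inl a)
    then have "a \<in> A" using pattern_letter[OF assms(2)] by blast
    then show ?thesis using eq[of "Inr k" "Inl a"] Inl by simp
  next
    case (Inr i)
    then show ?thesis using eq[of "Inr k" "Inr (\<kappa> i)"] \<kappa> by simp
  qed
  then have "v = fill (y \<circ> \<kappa>) \<circ> \<theta>" by (simp only: v fun_eq_iff) simp
  moreover have "range (y \<circ> \<kappa>) \<subseteq> A" using y(1) by auto
  ultimately show "v \<in> {fill z \<circ> \<theta> |z. range z \<subseteq> A}" by blast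
next
  fix v assume "v \<in> {fill z \<circ> \<theta> |z. range z \<subseteq> A}"
  then obtain z where z: "v = fill z \<circ> \<theta>" "range z \<subseteq> A" by blast
  have v: "range v \<subseteq> A" using fill_range[OF assms(2) z(2)] z(1) by simp
  have "Inl \<circ> v = substitute (Inl \<circ> z) \<theta>"
  proof
    show "(Inl \<circ> v) k = substitute (Inl \<circ> z) \<theta> k" for k
      by (cases "\<theta> k") (simp_all add: z(1) substitute_def)
  qed
  then have "coarser A (partition_of A (Inl \<circ> v)) (partition_of A \<theta>)"
    by (simp add: coarser_substitute)
  then show "v \<in> cube A (partition_of A \<theta>)"
    using partition_of_word_in_parts[OF v] word_of_partition_of[OF v] unfolding cube_def
    by (metis (mono_tags, lifting) image_eqI mem_Collect_eq)
qed

section \<open>Borel cubes and analytic relations\<close>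

lemma topspace_words: "x \<in> topspace (words A) \<longleftrightarrow> range x \<subseteq> A"
  by (auto simp: words_def PiE_def Pi_def)

text \<open>
  The cube is closed: with \<open>\<kappa> i\<close> a position of the variable \<open>Inr i\<close>, it is defined by the
  equations \<open>x k = fill (x \<circ> \<kappa>) (\<theta> k)\<close> between continuous functions with values in a discrete
  space.
\<close>

lemma borel_in_cube:
  assumes "finite A" "pattern A \<theta>"
  shows "borel_in (words A) (cube A (partition_of A \<theta>))"
proof -
  obtain \<kappa> where \<kappa>: "\<And>i. \<theta> (\<kappa> i) = Inr i" using pattern_positions[OF assms(2)] by blast
  define V where "V k = {x \<in> topspace (words A). x k = fill (x \<circ> \<kappa>) (\<theta> k)}" for k
  have proj: "continuous_map (words A) (discrete_topology A) (\<lambda>x. x k)" for k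
    unfolding words_def by (rule continuous_map_product_projection) simp
  have "continuous_map (words A) (discrete_topology A) (\<lambda>x. fill (x \<circ> \<kappa>) (\<theta> k))" for k
    using proj pattern_letter[OF assms(2)] by (cases "\<theta> k") auto
  then have "closedin (words A) (V k)" for k
    unfolding V_def by (intro closedin_continuous_maps_eq[of "discrete_topology A"] proj) simp_all
  then have "closedin (words A) (\<Inter>k. V k)" by blast
  moreover have "(\<Inter>k. V k) = cube A (partition_of A \<theta>)"
    unfolding cube_partition_of[OF assms]
  proof (intro equalityI subsetI)
    fix x assume "x \<in> (\<Inter>k. V k)"
    then have x: "range x \<subseteq> A" "\<And>k. x k = fill (x \<circ> \<kappa>) (\<theta> k)"
      by (auto simp only: V_def topspace_words)
    have "x = fill (x \<circ> \<kappa>) \<circ> \<theta>"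
    proof
      show "x k = (fill (x \<circ> \<kappa>) \<circ> \<theta>) k" for k using x(2)[of k] by (simp only: comp_apply)
    qed
    moreover have "range (x \<circ> \<kappa>) \<subseteq> A" using x(1) by auto
    ultimately show "x \<in> {fill z \<circ> \<theta> |z. range z \<subseteq> A}" by blast
  next
    fix x assume "x \<in> {fill z \<circ> \<theta> |z. range z \<subseteq> A}"
    then obtain z where z: "x = fill z \<circ> \<theta>" "range z \<subseteq> A" by blast
    then have "x \<circ> \<kappa> = z" by (simp add: fun_eq_iff \<kappa>)
    then show "x \<in> (\<Inter>k. V k)"
      using fill_range[OF assms(2) z(2)] z(1) by (simp add: V_def topspace_words)
  qed
  ultimately have "closedin (words A) (cube A (partition_of A \<theta>))" by simp
  then have "cube A (partition_of A \<theta>) = topspace (words A) -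
      (topspace (words A) - cube A (partition_of A \<theta>))"
    and "openin (words A) (topspace (words A) - cube A (partition_of A \<theta>))"
    by (auto simp: closedin_def)
  then show ?thesis
    unfolding borel_in_def by (metis mem_Collect_eq sigma_sets.Basic sigma_sets.Compl)
qed

lemma openin_baire_space_prefix:
  assumes "openin baire_space S" "b \<in> S"
  shows "\<exists>n. \<forall>b'. prefix n b' = prefix n b \<longrightarrow> b' \<in> S"
proof -
  obtain U where U: "finite {i. U i \<noteq> UNIV}" "b \<in> Pi\<^sub>E UNIV U" "Pi\<^sub>E UNIV U \<subseteq> S"
    using assms unfolding baire_space_def openin_product_topology_alt by auto
  obtain n where n: "\<And>i. U i \<noteq> UNIV \<Longrightarrow> i < n"
    using U(1) finite_nat_set_iff_bounded by auto
  have "b' \<in> S" if eq: "prefix n b' = prefix n b" for b'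
  proof -
    have "b' i = b i" if "i < n" for i
      using arg_cong[OF eq, of "\<lambda>l. l ! i"] that by simp
    then have "b' i \<in> U i" for i using U(2) n[of i] by (cases "U i = UNIV") auto
    then show ?thesis using U(3) by auto
  qed
  then show ?thesis by blast
qed

lemma continuous_map_discrete_locally_constant:
  assumes "continuous_map baire_space (discrete_topology A) g"
  shows "\<exists>n. \<forall>b'. prefix n b' = prefix n b \<longrightarrow> g b' = g b"
proof -
  have top: "topspace baire_space = UNIV" by (simp add: baire_space_def)
  have "g b \<in> A" using continuous_map_image_subset_topspace[OF assms] top by auto
  then have "openin baire_space {b' \<in> topspace baire_space. g b' \<in> {g b}}"
    by (intro openin_continuous_map_preimage[OF assms]) simp
  from openin_baire_space_prefix[OF this, of b] show ?thesis by (simp add: top)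
qed

text \<open>
  If \<open>E\<close> is the image of the continuous map \<open>f\<close>, then \<open>f b = (fill z \<circ> \<theta>, fill w \<circ> \<theta>)\<close> defines a closed
  relation between \<open>(z, w)\<close> and \<open>b\<close>, since each coordinate of either side depends on finitely
  many values of the arguments.  \<open>E\<close> may live on any set \<open>B\<close> of words here, which lets the two
  parts of the theorem be treated alike.
\<close>

lemma suslin_rel_pull:
  assumes E: "analytic_in (prod_topology (subtopology (words A) B) (subtopology (words A) B)) E"
  shows "suslin_rel A (pull \<theta> E)"
proof (cases "E = {}")
  case True
  then show ?thesis
    unfolding suslin_rel_def
    by (intro exI[of _ "\<lambda>_ _. False"]) (auto simp: closed_rel_def pull_def)
next
  case False
  then obtain f where f: "continuous_map baire_space
      (prod_topology (subtopology (words A) B) (subtopology (words A) B)) f"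
    and E_f: "range f = E"
    using E unfolding analytic_in_def by (auto simp: baire_space_def)
  have coord: "continuous_map baire_space (discrete_topology A) (\<lambda>b. fst (f b) k)"
    "continuous_map baire_space (discrete_topology A) (\<lambda>b. snd (f b) k)" for k
  proof -
    have "continuous_map baire_space (words A) (\<lambda>b. fst (f b))"
      "continuous_map baire_space (words A) (\<lambda>b. snd (f b))"
      using continuous_map_fst_of[OF f] continuous_map_snd_of[OF f]
      by (simp_all add: continuous_map_in_subtopology comp_def)
    then show "continuous_map baire_space (discrete_topology A) (\<lambda>b. fst (f b) k)"
      "continuous_map baire_space (discrete_topology A) (\<lambda>b. snd (f b) k)"
      unfolding words_def continuous_map_componentwise_UNIV by blast+
  qed
  define P where "P x b \<longleftrightarrow> f b = (fill (fst \<circ> x) \<circ> \<theta>, fill (snd \<circ> x) \<circ> \<theta>)" for x b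
  have "closed_rel (A \<times> A) P"
    unfolding closed_rel_def
  proof (intro allI impI)
    fix x b
    assume approx: "\<forall>n. \<exists>x' b'. range x' \<subseteq> A \<times> A \<and> prefix n x' = prefix n x \<and>
      prefix n b' = prefix n b \<and> P x' b'"
    have "fst (f b) k = fill (fst \<circ> x) (\<theta> k) \<and> snd (f b) k = fill (snd \<circ> x) (\<theta> k)" for k
    proof -
      obtain m where m: "\<And>b'. prefix m b' = prefix m b \<Longrightarrow> fst (f b') k = fst (f b) k"
        using continuous_map_discrete_locally_constant[OF coord(1)] by metis
      obtain l where l: "\<And>b'. prefix l b' = prefix l b \<Longrightarrow> snd (f b') k = snd (f b) k"
        using continuous_map_discrete_locally_constant[OF coord(2)] by metis
      \<comment> \<open>The only index at which \<open>x\<close> is consulted for coordinate \<open>k\<close>; for a constant any index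
        will do.\<close>
      define i where "i = (case \<theta> k of Inl a \<Rightarrow> 0 | Inr i \<Rightarrow> i)"
      define n where "n = Suc i + m + l"
      obtain x' b' where x': "prefix n x' = prefix n x" and b': "prefix n b' = prefix n b"
        and P: "P x' b'"
        using approx by blast
      have "take m (prefix n b') = take m (prefix n b)" "take l (prefix n b') = take l (prefix n b)"
        using b' by simp_all
      then have "prefix m b' = prefix m b" "prefix l b' = prefix l b"
        by (simp_all add: n_def min_def split: if_splits)
      then have "fst (f b) k = fill (fst \<circ> x') (\<theta> k) \<and> snd (f b) k = fill (snd \<circ> x') (\<theta> k)"
        using m[of b'] l[of b'] P by (simp add: P_def)
      moreover have "x' i = x i"
      proof -
        have "i < n" by (simp add: n_def)
        then show ?thesis using arg_cong[OF x', of "\<lambda>l. l ! i"] by simp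
      qed
      ultimately show ?thesis by (cases "\<theta> k") (auto simp: i_def)
    qed
    then show "P x b" unfolding P_def by (intro prod_eqI ext) simp_all
  qed
  moreover have "(z, w) \<in> pull \<theta> E \<longleftrightarrow> (\<exists>b. P (pairs z w) b)" for z w
  proof -
    have "fst \<circ> pairs z w = z" "snd \<circ> pairs z w = w" by (auto simp: pairs_def)
    then show ?thesis by (auto simp: pull_def P_def E_f[symmetric] image_iff dest: sym)
  qed
  ultimately show ?thesis unfolding suslin_rel_def by blast
qed

section \<open>Canonization of analytic equivalence relations\<close>

text \<open>
  The common source of both parts of the theorem: \<open>B\<close> is the cube of \<open>X\<close> in the first and a
  Borel set containing that cube in the second.  Since \<open>Q\<close> is reflexive, being letterwise
  \<open>Q\<close>-related is a property of the type, so it does not matter whether it is stated for the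
  words of the cube or for the values of the variables.
\<close>

lemma analytic_equiv_canonization:
  assumes A: "finite A" and X: "X \<in> parts A \<infinity>" "cube A X \<subseteq> B"
    and E: "analytic_equiv (words A) B E"
  obtains Y Q where "Y \<in> parts A \<infinity>" "coarser A Y X" "cube A Y \<subseteq> B" "equiv A Q"
    "borel_in (words A) (cube A Y)" "\<And>x. x \<in> cube A Y \<Longrightarrow> range x \<subseteq> A"
    "\<And>x y. x \<in> cube A Y \<Longrightarrow> y \<in> cube A Y \<Longrightarrow> (x, y) \<in> E \<longleftrightarrow> range (pairs x y) \<subseteq> Q"
proof -
  obtain \<phi> where \<phi>: "pattern A \<phi>" "partition_of A \<phi> = X" using pattern_of_parts[OF A X(1)] .
  have eq: "equiv B E" and an: "analytic_in
      (prod_topology (subtopology (words A) B) (subtopology (words A) B)) E"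
    using E by (simp_all add: analytic_equiv_def)
  have cube_X: "fill z \<circ> \<phi> \<in> B" if "range z \<subseteq> A" for z
    using X(2) that unfolding \<phi>(2)[symmetric] cube_partition_of[OF A \<phi>(1)] by blast
  have "sym (pull \<phi> E)" "trans (pull \<phi> E)" using eq by (auto simp: equiv_def sym_pull trans_pull)
  moreover have "(z, z) \<in> pull \<phi> E" if "range z \<subseteq> A" for z
    using cube_X[OF that] eq by (auto simp: pull_def equiv_def refl_on_def)
  moreover have "suslin_rel A (pull \<psi> (pull \<phi> E))" for \<psi>
    using suslin_rel_pull[OF an] pull_substitute by metis
  ultimately obtain \<eta> Q where \<eta>: "pattern A \<eta>" and Q: "equiv A Q" and
    can: "\<And>z w. range z \<subseteq> A \<Longrightarrow> range w \<subseteq> A \<Longrightarrow>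
       (z, w) \<in> pull \<eta> (pull \<phi> E) \<longleftrightarrow> range (pairs z w) \<subseteq> Q"
    using canonical_pattern[OF A] by metis
  define \<theta> where "\<theta> = substitute \<eta> \<phi>"
  have \<theta>: "pattern A \<theta>" using pattern_substitute[OF \<eta> \<phi>(1)] by (simp add: \<theta>_def)
  define Y where "Y = partition_of A \<theta>"
  have cube_Y: "cube A Y = {fill z \<circ> \<theta> |z. range z \<subseteq> A}"
    unfolding Y_def by (rule cube_partition_of[OF A \<theta>])
  show ?thesis
  proof (rule that)
    show "Y \<in> parts A \<infinity>" unfolding Y_def by (rule partition_of_in_parts[OF \<theta>])
    show "coarser A Y X" unfolding Y_def \<theta>_def \<phi>(2)[symmetric] by (rule coarser_substitute)
    show "cube A Y \<subseteq> B"
      using cube_X fill_range[OF \<eta>] unfolding cube_Y \<theta>_def fill_substitute by blast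
    show "equiv A Q" by (rule Q)
    show "borel_in (words A) (cube A Y)" unfolding Y_def by (rule borel_in_cube[OF A \<theta>])
    show "range x \<subseteq> A" if "x \<in> cube A Y" for x
      using that fill_range[OF \<theta>] unfolding cube_Y by blast
    fix x y assume "x \<in> cube A Y" "y \<in> cube A Y"
    then obtain z w where zw: "x = fill z \<circ> \<theta>" "y = fill w \<circ> \<theta>" "range z \<subseteq> A" "range w \<subseteq> A"
      unfolding cube_Y by blast
    have "Id_on A \<subseteq> Q" using Q by (auto simp: equiv_def refl_on_def)
    then have sub: "range (pairs u v) \<subseteq> Q \<longleftrightarrow> pair_type A u v \<subseteq> Q" for u v
      by (simp add: pair_type_def)
    have "(x, y) \<in> E \<longleftrightarrow> (z, w) \<in> pull \<eta> (pull \<phi> E)"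
      by (simp add: zw pull_def \<theta>_def fill_substitute)
    also have "\<dots> \<longleftrightarrow> pair_type A z w \<subseteq> Q" using can zw sub by simp
    also have "\<dots> \<longleftrightarrow> range (pairs x y) \<subseteq> Q"
      unfolding sub zw(1,2) pair_type_fill[OF \<theta> zw(3)] ..
    finally show "(x, y) \<in> E \<longleftrightarrow> range (pairs x y) \<subseteq> Q" .
  qed
qed

lemma block_rel_quotient:
  assumes Q: "equiv A Q" and "range x \<subseteq> A" "range y \<subseteq> A"
  shows "(x, y) \<in> block_rel A (A // Q) \<longleftrightarrow> range (pairs x y) \<subseteq> Q"
proof -
  have "(\<forall>B\<in>A // Q. x k \<in> B \<longleftrightarrow> y k \<in> B) \<longleftrightarrow> (x k, y k) \<in> Q" for k
  proof
    assume same: "\<forall>B\<in>A // Q. x k \<in> B \<longleftrightarrow> y k \<in> B"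
    have xk: "x k \<in> A" using assms(2) by auto
    have "y k \<in> Q `` {x k}"
      by (rule iffD1[OF bspec[OF same quotientI[OF xk]] equiv_class_self[OF Q xk]])
    then show "(x k, y k) \<in> Q" by simp
  next
    assume xy: "(x k, y k) \<in> Q"
    then have yx: "(y k, x k) \<in> Q" using Q by (meson equiv_def symD)
    show "\<forall>B\<in>A // Q. x k \<in> B \<longleftrightarrow> y k \<in> B"
      using in_quotient_imp_closed[OF Q _ _ xy] in_quotient_imp_closed[OF Q _ _ yx] by metis
  qed
  then show ?thesis using assms(2,3) by (auto simp: block_rel_def topspace_words pairs_def)
qed

lemma equiv_on_two_letters:
  assumes "card A = 2" "equiv A Q"
  shows "Q = A \<times> A \<or> Q = Id_on A"
proof -
  obtain a b where ab: "A = {a, b}" using assms(1) card_2_iff by metis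
  have Q: "Q \<subseteq> A \<times> A" "Id_on A \<subseteq> Q" "sym Q" using assms(2) by (auto simp: equiv_def refl_on_def)
  show ?thesis
  proof (cases "(a, b) \<in> Q")
    case True
    then have "(b, a) \<in> Q" using Q(3) by (rule symD[rotated])
    then have "A \<times> A \<subseteq> Q" using True Q(2) by (auto simp: ab)
    then show ?thesis using Q(1) by blast
  next
    case False
    then have "(b, a) \<notin> Q" using Q(3) by (meson symD)
    then have "Q \<subseteq> Id_on A" using False Q(1) by (auto simp: ab)
    then show ?thesis using Q(2) by blast
  qed
qed

theorem theorem2p1:
  fixes A :: "'a set"
  assumes "finite A" and "card A \<ge> 2"
  shows "(\<forall>X\<in>parts A \<infinity>. \<forall>E. analytic_equiv (words A) (cube A X) E \<longrightarrow>
      (\<exists>Y\<in>parts A \<infinity>. coarser A Y X \<and>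
         (restrict_rel E (cube A Y) = cube A Y \<times> cube A Y \<or>
          restrict_rel E (cube A Y) = Id_on (cube A Y) \<or>
          (\<exists>\<B>. partition_on A \<B> \<and>
             restrict_rel E (cube A Y) = restrict_rel (block_rel A \<B>) (cube A Y)))))
    \<and> (card A = 2 \<longrightarrow>
      (\<forall>B E. borel_in (words A) B \<and> B \<notin> ideal_C A \<and> analytic_equiv (words A) B E \<longrightarrow>
        (\<exists>C. borel_in (words A) C \<and> C \<subseteq> B \<and> C \<notin> ideal_C A \<and>
           (restrict_rel E C = C \<times> C \<or> restrict_rel E C = Id_on C))))"
proof (intro conjI ballI allI impI)
  fix X E assume X: "X \<in> parts A \<infinity>" and E: "analytic_equiv (words A) (cube A X) E"
  obtain Y Q where Y: "Y \<in> parts A \<infinity>" "coarser A Y X" and Q: "equiv A Q"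
    and words: "\<And>x. x \<in> cube A Y \<Longrightarrow> range x \<subseteq> A"
    and can: "\<And>x y. x \<in> cube A Y \<Longrightarrow> y \<in> cube A Y \<Longrightarrow> (x, y) \<in> E \<longleftrightarrow> range (pairs x y) \<subseteq> Q"
    using analytic_equiv_canonization[OF assms(1) X subset_refl E] by metis
  have "(x, y) \<in> E \<longleftrightarrow> (x, y) \<in> block_rel A (A // Q)" if "x \<in> cube A Y" "y \<in> cube A Y" for x y
    using can[OF that] block_rel_quotient[OF Q words words] that by simp
  then have "restrict_rel E (cube A Y) = restrict_rel (block_rel A (A // Q)) (cube A Y)"
    unfolding restrict_rel_def by blast
  then show "\<exists>Y\<in>parts A \<infinity>. coarser A Y X \<and>
         (restrict_rel E (cube A Y) = cube A Y \<times> cube A Y \<or>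
          restrict_rel E (cube A Y) = Id_on (cube A Y) \<or>
          (\<exists>\<B>. partition_on A \<B> \<and>
             restrict_rel E (cube A Y) = restrict_rel (block_rel A \<B>) (cube A Y)))"
    using Y partition_on_quotient[OF Q] by blast
next
  fix B E assume two: "card A = 2"
    and BE: "borel_in (words A) B \<and> B \<notin> ideal_C A \<and> analytic_equiv (words A) B E"
  then obtain X where X: "X \<in> parts A \<infinity>" "cube A X \<subseteq> B" by (auto simp: ideal_C_def)
  obtain Y Q where Y: "Y \<in> parts A \<infinity>" "cube A Y \<subseteq> B" "borel_in (words A) (cube A Y)"
    and Q: "equiv A Q" and words: "\<And>x. x \<in> cube A Y \<Longrightarrow> range x \<subseteq> A"
    and can: "\<And>x y. x \<in> cube A Y \<Longrightarrow> y \<in> cube A Y \<Longrightarrow> (x, y) \<in> E \<longleftrightarrow> range (pairs x y) \<subseteq> Q"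
    using analytic_equiv_canonization[OF assms(1) X, of E] BE by metis
  have "cube A Y \<notin> ideal_C A" using Y(1) by (auto simp: ideal_C_def)
  moreover have "restrict_rel E (cube A Y) = cube A Y \<times> cube A Y \<or>
      restrict_rel E (cube A Y) = Id_on (cube A Y)"
    using equiv_on_two_letters[OF two Q]
  proof
    assume "Q = A \<times> A"
    then have "(x, y) \<in> E" if "x \<in> cube A Y" "y \<in> cube A Y" for x y
      using can[OF that] words[OF that(1)] words[OF that(2)] by (auto simp: pairs_def)
    then show ?thesis unfolding restrict_rel_def by blast
  next
    assume Id: "Q = Id_on A"
    have "(x, y) \<in> E \<longleftrightarrow> x = y" if "x \<in> cube A Y" "y \<in> cube A Y" for x y
    proof -
      have "range (pairs x y) \<subseteq> Id_on A \<longleftrightarrow> (\<forall>k. x k = y k)"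
        using words[OF that(1)] by (auto simp: pairs_def Id_on_iff image_subset_iff)
      then show ?thesis using can[OF that] by (simp add: Id fun_eq_iff)
    qed
    then show ?thesis unfolding restrict_rel_def Id_on_def by auto
  qed
  ultimately show "\<exists>C. borel_in (words A) C \<and> C \<subseteq> B \<and> C \<notin> ideal_C A \<and>
           (restrict_rel E C = C \<times> C \<or> restrict_rel E C = Id_on C)"
    using Y by blast
qed

end
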